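(* Let $t_1,t_2,r_2,r_3$ be integers with $t_1,t_2,r_2,r_3\ge2$. Then $$\sup_{G_{21},G_{31},G_{32},P}\bigl[R_{\mathrm{PDF}}-\max(R_{\mathrm{DF}},R_{\mathrm{DT}})\bigr]=\infty,$$ where the supremum is over all $G_{21}\in\mathbb{C}^{r_2\times t_1}$, $G_{31}\in\mathbb{C}^{r_3\times t_1}$, $G_{32}\in\mathbb{C}^{r_3\times t_2}$ and all powers $P>0$, and $R_{\mathrm{PDF}}$, $R_{\mathrm{DF}}$, $R_{\mathrm{DT}}$ are the partial decode--forward, decode--forward, and direct-transmission bounds of the corresponding MIMO relay channel.
   Context: All logarithms are base 2, so rates and mutual informations are in bits. $(\cdot)^{\mathsf H}$ is the complex conjugate transpose. MIMO relay channel: given complex random vectors $\mathbf{X}_1$ in $\mathbb{C}^{t_1}$ (sender) and $\mathbf{X}_2$ in $\mathbb{C}^{t_2}$ (relay), the channel outputs are $$\mathbf{Y}_2=G_{21}\mathbf{X}_1+\mathbf{Z}_2,\qquad \mathbf{Y}_3=G_{31}\mathbf{X}_1+G_{32}\mathbf{X}_2+\mathbf{Z}_3,$$ where $\mathbf{Z}_2\sim\mathrm{CN}(0,I_{r_2})$ and $\mathbf{Z}_3\sim\mathrm{CN}(0,I_{r_3})$ are complex Gaussian, independent of each other and of the inputs (and of any auxiliary variable $\mathbf{U}$ below). Partial decode--forward bound: $$R_{\mathrm{PDF}}=\sup\min\{I(\mathbf{X}_1,\mathbf{X}_2;\mathbf{Y}_3),\ I(\mathbf{U};\mathbf{Y}_2\mid\mathbf{X}_2)+I(\mathbf{X}_1;\mathbf{Y}_3\mid\mathbf{X}_2,\mathbf{U})\},$$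 over all joint distributions $F(\mathbf{u},\mathbf{x}_1,\mathbf{x}_2)$ with $\mathsf{E}(\mathbf{X}_j^{\mathsf H}\mathbf{X}_j)\le P$, $j=1,2$, where $\mathbf{U}$ is an arbitrary auxiliary random vector. Decode--forward bound: $$R_{\mathrm{DF}}=\sup\min\{I(\mathbf{X}_1,\mathbf{X}_2;\mathbf{Y}_3),\ I(\mathbf{X}_1;\mathbf{Y}_2\mid\mathbf{X}_2)\}$$ over all $F(\mathbf{x}_1,\mathbf{x}_2)$ with $\mathsf{E}(\mathbf{X}_j^{\mathsf H}\mathbf{X}_j)\le P$, $j=1,2$; equivalently $R_{\mathrm{DF}}=\max_K\min\{\log|I_{r_3}+G_{3*}KG_{3*}^{\mathsf H}|,\ \log|I_{r_2}+G_{21}K_{1|2}G_{21}^{\mathsf H}|\}$, with $G_{3*}=[G_{31}\ G_{32}]$, the maximum over $K=\begin{bmatrix} K_1 & K_{12} \\ K_{12}^{\mathsf H} & K_2 \end{bmatrix}\succeq0$ of size $(t_1+t_2)\times(t_1+t_2)$ with $\mathrm{tr}(K_j)\le P$, $j=1,2$, and $K_{1|2}=K_1-K_{12}K_2^{-1}K_{12}^{\mathsf H}$ (generalized inverse if $K_2$ is singular). Direct-transmission bound: with $\mathbf{X}_2=0$, $$R_{\mathrm{DT}}=\sup_{F(\mathbf{x}_1):\,\mathsf{E}(\mathbf{X}_1^{\mathsf H}\mathbf{X}_1)\le P}I(\mathbf{X}_1;\mathbf{Y}_3)=\max_{K_1\succeq0,\ \mathrm{tr}(K_1)\le P}\log|I_{r_3}+G_{31}K_1G_{31}^{\mathsf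 H}|.$$ *)

theory Defs
  imports "HOL-Probability.Probability"
begin

text \<open>
  Standard circularly symmetric complex Gaussian vector: the real and imaginary parts of all
  entries are independent with variance 1/2. The standard basis of \<^typ>\<open>complex ^ 'n\<close> as a real
  Euclidean space is orthonormal, so \<^const>\<open>lborel\<close> is Lebesgue measure in these real and
  imaginary parts.
\<close>
definition CN :: "(complex ^ 'n::finite) measure" where
  "CN = density lborel (\<lambda>z. ennreal (exp (- (norm z)\<^sup>2) / pi ^ CARD('n)))"

text \<open>
  Input distributions under the power constraint; \<open>(norm x)\<^sup>2\<close> is \<open>x\<^sup>H x\<close>. The auxiliary vector
  of an element of \<open>pdf_inputs k P\<close> takes values in \<open>k\<close>-dimensional complex space.
\<close>
definition aux_space :: "nat \<Rightarrow> (nat \<Rightarrow> complex) measure" where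
  "aux_space k = (\<Pi>\<^sub>M i\<in>{..<k}. borel)"

definition pdf_inputs ::
  "nat \<Rightarrow> real \<Rightarrow> ((nat \<Rightarrow> complex) \<times> (complex ^ 't1) \<times> (complex ^ 't2)) measure set" where
  "pdf_inputs k P = {F. prob_space F \<and> sets F = sets (aux_space k \<Otimes>\<^sub>M borel \<Otimes>\<^sub>M borel) \<and>
     (\<integral>\<^sup>+ (u, x1, x2). ennreal ((norm x1)\<^sup>2) \<partial>F) \<le> ennreal P \<and>
     (\<integral>\<^sup>+ (u, x1, x2). ennreal ((norm x2)\<^sup>2) \<partial>F) \<le> ennreal P}"

definition df_inputs :: "real \<Rightarrow> ((complex ^ 't1) \<times> (complex ^ 't2)) measure set" where
  "df_inputs P = {F. prob_space F \<and> sets F = sets (borel \<Otimes>\<^sub>M borel) \<and>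
     (\<integral>\<^sup>+ (x1, x2). ennreal ((norm x1)\<^sup>2) \<partial>F) \<le> ennreal P \<and>
     (\<integral>\<^sup>+ (x1, x2). ennreal ((norm x2)\<^sup>2) \<partial>F) \<le> ennreal P}"

definition dt_inputs :: "real \<Rightarrow> (complex ^ 't1) measure set" where
  "dt_inputs P = {F. prob_space F \<and> sets F = sets borel \<and>
     (\<integral>\<^sup>+ x1. ennreal ((norm x1)\<^sup>2) \<partial>F) \<le> ennreal P}"

text \<open>
  In the library, \<open>I(X;Y|Z) = I(X;(Y,Z)) - I(X;Z)\<close>, where mutual information is a real number
  given by a Bochner integral, so the two terms on the right have to be finite for the difference
  to be meaningful. Conditional mutual information is symmetric in \<open>X\<close> and \<open>Y\<close>; below, the channel
  output is always put in the place of \<open>X\<close>. The output is the input plus Gaussian noise and the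
  inputs have finite power, so its mutual information with any variables independent of the noise
  is finite, and the corresponding joint law is absolutely continuous with respect to the product
  of the marginals. With the arguments swapped this would fail, e.g. if \<open>U = X2\<close> has a density.

  The suprema are taken in \<^typ>\<open>ereal\<close>.
\<close>

definition R_PDF ::
  "complex ^ 't1 ^ 'r2 \<Rightarrow> complex ^ 't1 ^ 'r3 \<Rightarrow> complex ^ 't2 ^ 'r3 \<Rightarrow> real \<Rightarrow> ereal" where
  "R_PDF G21 G31 G32 P = (SUP k. SUP F \<in> pdf_inputs k P.
     (let M = F \<Otimes>\<^sub>M (CN :: (complex ^ 'r2) measure) \<Otimes>\<^sub>M (CN :: (complex ^ 'r3) measure);
          U = (\<lambda>((u, x1, x2), z2, z3). u);
          X1 = (\<lambda>((u, x1, x2), z2, z3). x1);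
          X2 = (\<lambda>((u, x1, x2), z2, z3). x2);
          Y2 = (\<lambda>((u, x1, x2), z2, z3). G21 *v x1 + z2);
          Y3 = (\<lambda>((u, x1, x2), z2, z3). G31 *v x1 + G32 *v x2 + z3)
      in ereal (min
        (prob_space.mutual_information M 2 (borel \<Otimes>\<^sub>M borel) borel (\<lambda>w. (X1 w, X2 w)) Y3)
        (prob_space.conditional_mutual_information M 2 borel (aux_space k) borel Y2 U X2 +
         prob_space.conditional_mutual_information M 2 borel borel (borel \<Otimes>\<^sub>M aux_space k)
           Y3 X1 (\<lambda>w. (X2 w, U w))))))"

definition R_DF ::
  "complex ^ 't1 ^ 'r2 \<Rightarrow> complex ^ 't1 ^ 'r3 \<Rightarrow> complex ^ 't2 ^ 'r3 \<Rightarrow> real \<Rightarrow> ereal" where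
  "R_DF G21 G31 G32 P = (SUP F \<in> df_inputs P.
     (let M = F \<Otimes>\<^sub>M (CN :: (complex ^ 'r2) measure) \<Otimes>\<^sub>M (CN :: (complex ^ 'r3) measure);
          X1 = (\<lambda>((x1, x2), z2, z3). x1);
          X2 = (\<lambda>((x1, x2), z2, z3). x2);
          Y2 = (\<lambda>((x1, x2), z2, z3). G21 *v x1 + z2);
          Y3 = (\<lambda>((x1, x2), z2, z3). G31 *v x1 + G32 *v x2 + z3)
      in ereal (min
        (prob_space.mutual_information M 2 (borel \<Otimes>\<^sub>M borel) borel (\<lambda>w. (X1 w, X2 w)) Y3)
        (prob_space.conditional_mutual_information M 2 borel borel borel Y2 X1 X2))))"

definition R_DT :: "complex ^ 't1 ^ 'r3 \<Rightarrow> real \<Rightarrow> ereal" where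
  "R_DT G31 P = (SUP F \<in> dt_inputs P.
     (let M = F \<Otimes>\<^sub>M (CN :: (complex ^ 'r3) measure);
          X1 = (\<lambda>(x1, z3). x1);
          Y3 = (\<lambda>(x1, z3). G31 *v x1 + z3)
      in ereal (prob_space.mutual_information M 2 borel borel X1 Y3)))"

end

theory Submission
  imports Defs
begin

text \<open>
  Let the relay see only the entry \<open>a\<close> of \<open>X\<^sub>1\<close>, and let the destination see another entry \<open>b\<close> of
  \<open>X\<^sub>1\<close> and an entry \<open>c\<close> of \<open>X\<^sub>2\<close> on two different antennas, all with gain \<open>1\<close>. Decode-forward is
  limited by the scalar channel from \<open>a\<close> to the relay and direct transmission by the scalar channel
  from \<open>b\<close> to the destination, so both are at most \<open>log P + O(1)\<close>. Partial decode-forward with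
  \<open>U = a\<close> and independent \<open>a\<close>, \<open>b\<close>, \<open>c\<close> uses both scalar channels and reaches \<open>2 log P - O(1)\<close>.

  The upper bounds compare the output density with that of a Gaussian input: the mutual information
  is at most the mean of \<open>ln (k / q)\<close> for the conditional output density \<open>k\<close> and any probability
  density \<open>q\<close>. For the lower bounds the inputs are uniform on a disc of radius \<open>R = sqrt P / 2\<close>, so that the
  (conditional) output densities are uniformly \<open>O(R\<^sup>-\<^sup>2)\<close> per scalar input.
\<close>

subsection \<open>Gaussian densities\<close>

text \<open>The entry \<open>c\<close> is there for the term \<open>I(X1,X2;Y3)\<close>, which also
  limits partial decode-forward: the destination can receive twice \<open>log P\<close> only with
  \<open>b\<close> and \<open>c\<close> on separate antennas. An unbounded gap needs just the
  coefficients 2 and 1 of \<open>log P\<close>, so exact Gaussian entropies and determinants give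
  way to crude bounds with additive constants.

  The obstacle is the form of the information terms. A mutual information is a Bochner integral,
  hence 0 when its integrand is not integrable, and a conditional one is a difference of two of
  them. In the upper bounds, which concern every admissible input, the subtracted term has to be
  nonnegative; in the lower bounds it has to be controlled even if it takes the default value.
  Inputs may lack densities, and \<open>U\<close> is a function of \<open>X1\<close>. Densities are
  therefore taken with respect to the law of the conditioning variables times Lebesgue measure on
  the output, where the noise makes them positive.

  Discs suit the lower bounds because their density is at most the reciprocal area: a bound on an
  output density reduces to Gaussian integrals over the plane.\<close>

lemma nn_integral_exp_minus_sq:
  fixes a :: real
  assumes "a > 0"
  shows "(\<integral>\<^sup>+ t. ennreal (exp (- (a * t\<^sup>2))) \<partial>lborel) = ennreal (sqrt (pi / a))"
proof -
  define s where "s = sqrt (1 / (2 * a))"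
  have s: "s > 0" "2 * s\<^sup>2 = 1 / a" using assms by (auto simp: s_def)
  have e: "exp (- (a * t\<^sup>2)) = sqrt (pi / a) * normal_density 0 s t" for t
  proof -
    have "2 * pi * s\<^sup>2 = pi / a" using s by (simp add: field_simps)
    moreover have "- (t - 0)\<^sup>2 / (2 * s\<^sup>2) = - (a * t\<^sup>2)" unfolding s(2) by simp
    ultimately show ?thesis using assms by (simp add: normal_density_def)
  qed
  have "(\<integral>\<^sup>+ t. ennreal (normal_density 0 s t) \<partial>lborel) = 1"
    using s by (subst nn_integral_eq_integral) auto
  then show ?thesis
    unfolding e using assms by (simp add: ennreal_mult nn_integral_cmult)
qed

lemma nn_integral_exp_minus_weighted_norm:
  fixes \<alpha> :: "'a::euclidean_space \<Rightarrow> real"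
  assumes "\<And>b. b \<in> Basis \<Longrightarrow> \<alpha> b > 0"
  shows "(\<integral>\<^sup>+ y. ennreal (exp (- (\<Sum>b\<in>Basis. \<alpha> b * (y \<bullet> b)\<^sup>2))) \<partial>lborel)
    = ennreal (\<Prod>b\<in>Basis. sqrt (pi / \<alpha> b))"
proof -
  have "(\<integral>\<^sup>+ y. ennreal (exp (- (\<Sum>b\<in>Basis. \<alpha> b * (y \<bullet> b)\<^sup>2))) \<partial>lborel)
    = (\<integral>\<^sup>+ y. (\<Prod>b\<in>Basis. (\<lambda>b t. ennreal (exp (- (\<alpha> b * t\<^sup>2)))) b (y \<bullet> b)) \<partial>lborel)"
    by (intro nn_integral_cong) (simp add: prod_ennreal exp_sum[symmetric] sum_negf)
  also have "\<dots> = (\<Prod>b\<in>(Basis::'a set). (\<integral>\<^sup>+ t. ennreal (exp (- (\<alpha> b * t\<^sup>2))) \<partial>lborel))"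
    by (subst nn_integral_lborel_prod) auto
  also have "\<dots> = (\<Prod>b\<in>(Basis::'a set). ennreal (sqrt (pi / \<alpha> b)))"
    using assms by (intro prod.cong refl nn_integral_exp_minus_sq)
  also have "\<dots> = ennreal (\<Prod>b\<in>Basis. sqrt (pi / \<alpha> b))"
    using assms by (intro prod_ennreal) (simp add: less_imp_le)
  finally show ?thesis .
qed

lemma norm_sq_eq_sum_Basis:
  fixes y :: "'a::euclidean_space"
  shows "(norm y)\<^sup>2 = (\<Sum>b\<in>Basis. (y \<bullet> b)\<^sup>2)"
  unfolding power2_norm_eq_inner by (subst euclidean_inner) (simp add: power2_eq_square)

lemma vec_nth_measurable [measurable (raw)]:
  fixes f :: "'a \<Rightarrow> complex ^ 'n::finite"
  assumes "f \<in> borel_measurable M"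
  shows "(\<lambda>x. f x $ i) \<in> borel_measurable M"
  by (rule measurable_compose[OF assms])
     (auto intro!: borel_measurable_continuous_onI continuous_intros)

lemma axis_borel_measurable [measurable]:
  "(axis i :: complex \<Rightarrow> complex ^ 'n::finite) \<in> borel_measurable borel"
proof -
  have "(axis i :: complex \<Rightarrow> complex ^ 'n) = (\<lambda>x. \<chi> j. if j = i then x else 0)"
    by (auto simp: axis_def fun_eq_iff)
  also have "\<dots> \<in> borel_measurable borel"
  proof (intro borel_measurable_continuous_onI continuous_on_vec_lambda)
    show "continuous_on UNIV (\<lambda>x :: complex. if j = i then x else 0)" for j :: 'n
      by (cases "j = i") simp_all
  qed
  finally show ?thesis .
qed

lemma axis_measurable [measurable (raw)]:
  assumes "f \<in> borel_measurable M"
  shows "(\<lambda>x. axis i (f x) :: complex ^ 'n::finite) \<in> borel_measurable M"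
  by (rule measurable_compose[OF assms axis_borel_measurable])

lemma bij_betw_axis_Basis:
  "bij_betw (\<lambda>(i, u). axis i u) ((UNIV :: 'n::finite set) \<times> (Basis :: 'a::euclidean_space set)) Basis"
proof (rule bij_betw_imageI)
  show "inj_on (\<lambda>(i, u). axis i u) ((UNIV :: 'n set) \<times> (Basis :: 'a set))"
    by (auto simp: inj_on_def axis_eq_axis)
qed (auto simp: Basis_vec_def)

lemma prod_Basis_vec_complex:
  fixes g :: "complex ^ 'n::finite \<Rightarrow> real"
  shows "(\<Prod>b\<in>Basis. g b) = (\<Prod>i\<in>UNIV. g (axis i 1) * g (axis i \<i>))"
proof -
  have "(\<Prod>b\<in>Basis. g b) = (\<Prod>(i, u)\<in>(UNIV :: 'n set) \<times> (Basis :: complex set). g (axis i u))"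
    using prod.reindex_bij_betw[OF bij_betw_axis_Basis, of g] by (simp add: case_prod_unfold)
  also have "\<dots> = (\<Prod>i\<in>UNIV. \<Prod>u\<in>(Basis :: complex set). g (axis i u))"
    by (rule prod.cartesian_product[symmetric])
  also have "\<dots> = (\<Prod>i\<in>UNIV. g (axis i 1) * g (axis i \<i>))"
    by (simp add: Basis_complex_def)
  finally show ?thesis .
qed

lemma norm_vec_sq: "(norm (y :: complex ^ 'n::finite))\<^sup>2 = (\<Sum>i\<in>UNIV. (norm (y $ i))\<^sup>2)"
  by (simp add: norm_vec_def L2_set_def sum_nonneg)

lemma norm_add_sq_le: "(norm (x + y :: 'v::real_normed_vector))\<^sup>2 \<le> 2 * (norm x)\<^sup>2 + 2 * (norm y)\<^sup>2"
proof -
  have "(norm (x + y))\<^sup>2 \<le> (norm x + norm y)\<^sup>2"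
    by (intro power_mono norm_triangle_ineq) simp
  also have "\<dots> \<le> 2 * (norm x)\<^sup>2 + 2 * (norm y)\<^sup>2"
    using sum_squares_bound[of "norm x" "norm y"] by (simp add: power2_sum)
  finally show ?thesis .
qed

lemma norm_axis_complex: "norm (axis i x :: complex ^ 'n::finite) = norm x"
proof -
  have "(norm (axis i x :: complex ^ 'n))\<^sup>2 = (norm x)\<^sup>2"
    unfolding norm_vec_sq by (simp add: sum.remove[of UNIV i] axis_def)
  then show ?thesis by simp
qed

lemma nn_integral_exp_minus_coordinates:
  fixes \<beta> :: "'n::finite \<Rightarrow> real"
  assumes b: "\<And>i. \<beta> i > 0"
  shows "(\<integral>\<^sup>+ y. ennreal (exp (- (\<Sum>i\<in>UNIV. \<beta> i * (norm (y $ i :: complex))\<^sup>2))) \<partial>lborel)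
    = ennreal (\<Prod>i\<in>UNIV. pi / \<beta> i)"
proof -
  \<comment> \<open>A basis vector \<open>axis i u\<close> is nonzero in coordinate \<open>i\<close>
    only, so the choice recovers \<open>i\<close>. Its real and imaginary directions then share the
    weight \<open>\<beta> i\<close> and together contribute \<open>pi / \<beta> i\<close>.\<close>
  define \<alpha> where "\<alpha> v = \<beta> (SOME i. v $ i \<noteq> 0)" for v :: "complex ^ 'n"
  have a: "\<alpha> (axis i u) = \<beta> i" if "u \<noteq> 0" for i u
  proof -
    have "(SOME j. axis i u $ j \<noteq> 0) = i"
      using that by (intro some_equality) (auto simp: axis_def split: if_splits)
    then show ?thesis by (simp add: \<alpha>_def)
  qed
  have s: "(\<Sum>i\<in>UNIV. \<beta> i * (norm (y $ i))\<^sup>2) = (\<Sum>v\<in>Basis. \<alpha> v * (y \<bullet> v)\<^sup>2)" for y :: "complex ^ 'n"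
  proof -
    have "(\<Sum>v\<in>Basis. \<alpha> v * (y \<bullet> v)\<^sup>2)
      = (\<Sum>(i, u)\<in>(UNIV :: 'n set) \<times> (Basis :: complex set). \<alpha> (axis i u) * (y \<bullet> axis i u)\<^sup>2)"
      using sum.reindex_bij_betw[OF bij_betw_axis_Basis, of "\<lambda>v. \<alpha> v * (y \<bullet> v)\<^sup>2"]
      by (simp add: case_prod_unfold)
    also have "\<dots> = (\<Sum>i\<in>UNIV. \<Sum>u\<in>(Basis :: complex set). \<alpha> (axis i u) * (y \<bullet> axis i u)\<^sup>2)"
      by (rule sum.cartesian_product[symmetric])
    also have "\<dots> = (\<Sum>i\<in>UNIV. \<beta> i * (norm (y $ i))\<^sup>2)"
      by (simp add: Basis_complex_def a inner_axis cmod_power2 inner_complex_def distrib_left)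
    finally show ?thesis by simp
  qed
  have pos: "\<alpha> v > 0" for v by (simp add: \<alpha>_def b)
  have "(\<integral>\<^sup>+ y. ennreal (exp (- (\<Sum>i\<in>UNIV. \<beta> i * (norm (y $ i :: complex))\<^sup>2))) \<partial>lborel)
     = ennreal (\<Prod>v\<in>(Basis :: (complex ^ 'n) set). sqrt (pi / \<alpha> v))"
    unfolding s by (rule nn_integral_exp_minus_weighted_norm) (rule pos)
  also have "(\<Prod>v\<in>(Basis :: (complex ^ 'n) set). sqrt (pi / \<alpha> v)) = (\<Prod>i\<in>UNIV. pi / \<beta> i)"
    unfolding prod_Basis_vec_complex using b by (simp add: a less_imp_le real_sqrt_mult_self abs_of_pos)
  finally show ?thesis .
qed

definition cn_density :: "complex ^ 'n::finite \<Rightarrow> real" where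
  "cn_density z = exp (- (norm z)\<^sup>2) / pi ^ CARD('n)"

lemma CN_eq: "CN = density lborel (\<lambda>z. ennreal (cn_density z))"
  by (simp add: CN_def cn_density_def)

lemma cn_density_measurable [measurable]: "cn_density \<in> borel_measurable borel"
  unfolding cn_density_def[abs_def] by measurable

lemma cn_density_pos [simp]: "cn_density z > 0"
  by (simp add: cn_density_def)

lemma cn_density_nonneg [simp]: "cn_density z \<ge> 0"
  by (simp add: less_imp_le)

lemma cn_density_le_1: "cn_density z \<le> 1"
proof -
  have "exp (- (norm z)\<^sup>2) \<le> 1" by simp
  also have "1 \<le> pi ^ CARD('a)" using pi_ge_two by (intro one_le_power) linarith
  finally show ?thesis by (simp add: cn_density_def)
qed

lemma ln_cn_density:
  "ln (cn_density (z :: complex ^ 'n::finite)) = - (norm z)\<^sup>2 - real CARD('n) * ln pi"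
  by (simp add: cn_density_def ln_div ln_realpow)

lemma sets_CN [simp, measurable_cong]: "sets CN = sets borel"
  by (simp add: CN_def)

lemma space_CN [simp]: "space CN = UNIV"
  by (simp add: CN_def)

lemma nn_integral_CN:
  "g \<in> borel_measurable borel \<Longrightarrow> (\<integral>\<^sup>+ z. g z \<partial>CN) = (\<integral>\<^sup>+ z. ennreal (cn_density z) * g z \<partial>lborel)"
  unfolding CN_eq by (subst nn_integral_density) auto

lemma prob_space_CN: "prob_space (CN :: (complex ^ 'n::finite) measure)"
proof
  have "emeasure (CN :: (complex ^ 'n) measure) UNIV = (\<integral>\<^sup>+ z. 1 \<partial>(CN :: (complex ^ 'n) measure))"
    by simp
  also have "\<dots> = (\<integral>\<^sup>+ z. ennreal (1 / pi ^ CARD('n)) *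
      ennreal (exp (- (\<Sum>i\<in>UNIV. 1 * (norm ((z :: complex ^ 'n) $ i))\<^sup>2))) \<partial>lborel)"
    by (subst nn_integral_CN)
       (auto intro!: nn_integral_cong simp: cn_density_def norm_vec_sq ennreal_mult[symmetric])
  also have "\<dots> = ennreal (1 / pi ^ CARD('n)) * ennreal (\<Prod>i\<in>(UNIV::'n set). pi / 1)"
    by (subst nn_integral_cmult) (use nn_integral_exp_minus_coordinates[of "\<lambda>_ :: 'n. 1"] in auto)
  also have "\<dots> = 1"
    by (simp add: ennreal_mult[symmetric])
  finally show "emeasure (CN :: (complex ^ 'n) measure) (space CN) = 1" by simp
qed

lemma integrable_CN_norm_sq: "integrable (CN :: (complex ^ 'n::finite) measure) (\<lambda>z. (norm z)\<^sup>2)"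
proof (rule integrableI_nonneg)
  let ?c = "ennreal (2 / pi ^ CARD('n))"
  have "(\<integral>\<^sup>+ z. ennreal ((norm z)\<^sup>2) \<partial>(CN :: (complex ^ 'n) measure))
    = (\<integral>\<^sup>+ z. ennreal (cn_density z * (norm (z :: complex ^ 'n))\<^sup>2) \<partial>lborel)"
    by (subst nn_integral_CN) (auto simp: ennreal_mult)
  also have "\<dots> \<le> (\<integral>\<^sup>+ z. ?c * ennreal (exp (- (\<Sum>i\<in>UNIV. (1/2) * (norm ((z :: complex ^ 'n) $ i))\<^sup>2))) \<partial>lborel)"
  proof (rule nn_integral_mono)
    fix z :: "complex ^ 'n"
    let ?t = "(norm z)\<^sup>2"
    \<comment> \<open>Half of the Gaussian exponent pays for the factor \<open>?t\<close>, which
      leaves a Gaussian of doubled variance.\<close>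
    have "?t / 2 \<le> exp (?t / 2)" using exp_ge_add_one_self[of "?t / 2"] by linarith
    then have "exp (- ?t) * ?t \<le> exp (- ?t) * (2 * exp (?t / 2))" by (intro mult_left_mono) auto
    also have "\<dots> = 2 * exp (- (?t / 2))" by (simp add: exp_add[symmetric])
    finally have "cn_density z * ?t \<le> 2 / pi ^ CARD('n) * exp (- (?t / 2))"
      by (simp add: cn_density_def divide_simps)
    then show "ennreal (cn_density z * ?t) \<le> ?c * ennreal (exp (- (\<Sum>i\<in>UNIV. (1/2) * (norm (z $ i))\<^sup>2)))"
      by (simp add: norm_vec_sq sum_divide_distrib ennreal_mult[symmetric] ennreal_leI)
  qed
  also have "\<dots> = ?c * ennreal (\<Prod>i\<in>(UNIV::'n set). pi / (1/2))"
    by (subst nn_integral_cmult) (use nn_integral_exp_minus_coordinates[of "\<lambda>_ :: 'n. 1/2"] in auto)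
  also have "\<dots> < \<infinity>" by (simp add: ennreal_mult_less_top)
  finally show "(\<integral>\<^sup>+ z. ennreal ((norm z)\<^sup>2) \<partial>(CN :: (complex ^ 'n) measure)) < \<infinity>" .
qed auto

text \<open>The output density that a Gaussian input of power \<open>s - 1\<close> on the \<open>i\<close>-th coordinate would produce.\<close>

definition spike_density :: "real \<Rightarrow> 'n \<Rightarrow> complex ^ 'n::finite \<Rightarrow> real" where
  "spike_density s i y = exp (- ((norm y)\<^sup>2 - (1 - 1 / s) * (norm (y $ i))\<^sup>2)) / (s * pi ^ CARD('n))"

lemma spike_density_measurable [measurable]: "spike_density s i \<in> borel_measurable borel"
  unfolding spike_density_def[abs_def] by measurable

lemma spike_density_pos: "s > 0 \<Longrightarrow> spike_density s i y > 0"
  by (simp add: spike_density_def)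

lemma nn_integral_spike_density:
  fixes i :: "'n::finite"
  assumes s: "s > 0"
  shows "(\<integral>\<^sup>+ y. ennreal (spike_density s i y) \<partial>lborel) = 1"
proof -
  define \<beta> where "\<beta> j = (if j = i then 1 / s else 1)" for j
  have e: "(norm y)\<^sup>2 - (1 - 1 / s) * (norm (y $ i))\<^sup>2 = (\<Sum>j\<in>UNIV. \<beta> j * (norm (y $ j))\<^sup>2)"
    for y :: "complex ^ 'n"
    unfolding norm_vec_sq
    by (simp add: sum.remove[of UNIV i] \<beta>_def algebra_simps)
  have "(\<integral>\<^sup>+ y. ennreal (spike_density s i y) \<partial>lborel)
    = (\<integral>\<^sup>+ y. ennreal (1 / (s * pi ^ CARD('n))) *
        ennreal (exp (- (\<Sum>j\<in>UNIV. \<beta> j * (norm ((y :: complex ^ 'n) $ j))\<^sup>2))) \<partial>lborel)"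
    unfolding spike_density_def e using s by (simp add: ennreal_mult[symmetric])
  also have "\<dots> = ennreal (1 / (s * pi ^ CARD('n))) * ennreal (\<Prod>j\<in>UNIV. pi / \<beta> j)"
    using s by (subst nn_integral_cmult) (auto simp: nn_integral_exp_minus_coordinates \<beta>_def)
  also have "(\<Prod>j\<in>UNIV. pi / \<beta> j) = s * pi ^ CARD('n)"
    using s by (simp add: prod.remove[of UNIV i] \<beta>_def power_Suc[symmetric] del: power_Suc)
  also have "ennreal (1 / (s * pi ^ CARD('n))) * ennreal (s * pi ^ CARD('n)) = 1"
    using s by (simp add: ennreal_mult[symmetric])
  finally show ?thesis .
qed

text \<open>Output and noise differ in coordinate \<open>i\<close> only, so the other coordinates
  and the powers of \<open>pi\<close> cancel. What is left is a scalar channel: if \<open>s\<close>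
  is of the order of the output power, the quotient has bounded mean and \<open>ln s\<close> carries
  the whole growth.\<close>

lemma ln_cn_density_div_spike_density:
  fixes i :: "'n::finite"
  assumes s: "s > 0"
  shows "ln (cn_density z / spike_density s i (axis i x + z))
    = ln s + (norm (x + z $ i))\<^sup>2 / s - (norm (z $ i))\<^sup>2"
proof -
  have e: "(norm (axis i x + z))\<^sup>2 - (norm (x + z $ i))\<^sup>2 = (norm z)\<^sup>2 - (norm (z $ i))\<^sup>2"
    unfolding norm_vec_sq by (simp add: sum.remove[of UNIV i] axis_def)
  have "ln (spike_density s i (axis i x + z))
    = - ((norm (axis i x + z))\<^sup>2 - (1 - 1 / s) * (norm (x + z $ i))\<^sup>2) - ln s - real CARD('n) * ln pi"
    using s by (simp add: spike_density_def ln_div ln_mult ln_realpow)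
  moreover have "ln (cn_density z / spike_density s i (axis i x + z))
    = ln (cn_density z) - ln (spike_density s i (axis i x + z))"
    using cn_density_pos[of z, THEN less_imp_neq] spike_density_pos[OF s, of i "axis i x + z"]
    by (auto simp: ln_div simp del: cn_density_pos)
  ultimately show ?thesis
    using e by (simp add: ln_cn_density algebra_simps)
qed

lemma nn_integral_exp_complex:
  "(\<integral>\<^sup>+ c. ennreal (exp (- (norm (w - c :: complex))\<^sup>2)) \<partial>lborel) = ennreal pi"
proof -
  have "(\<integral>\<^sup>+ c. ennreal (exp (- (norm (w - c :: complex))\<^sup>2)) \<partial>lborel)
     = (\<integral>\<^sup>+ c. ennreal (exp (- (norm (c :: complex))\<^sup>2)) \<partial>(distr lborel borel ((+) (-w))))"
    by (subst nn_integral_distr) (auto simp: norm_minus_commute intro!: nn_integral_cong)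
  also have "\<dots> = (\<integral>\<^sup>+ c. ennreal (exp (- (\<Sum>b\<in>Basis. 1 * ((c :: complex) \<bullet> b)\<^sup>2))) \<partial>lborel)"
    by (simp add: lborel_distr_plus norm_sq_eq_sum_Basis)
  also have "\<dots> = ennreal (\<Prod>b\<in>(Basis :: complex set). sqrt (pi / 1))"
    by (rule nn_integral_exp_minus_weighted_norm) auto
  also have "(\<Prod>b\<in>(Basis :: complex set). sqrt (pi / 1)) = pi"
    by (simp add: Basis_complex_def)
  finally show ?thesis .
qed

subsection \<open>Mutual information through conditional densities\<close>

text \<open>In the integrable case this is Gibbs' inequality. Otherwise the Bochner integral has its
  default value 0, so absolute continuity alone suffices.\<close>

lemma KL_divergence_nonneg_ac:
  assumes "1 < b" and P: "prob_space P" and Q: "prob_space Q"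
    and ac: "absolutely_continuous P Q" "sets Q = sets P"
  shows "0 \<le> KL_divergence b P Q"
proof -
  interpret P: information_space P b
    using P \<open>1 < b\<close> by (simp add: information_space_def information_space_axioms_def)
  interpret Q: prob_space Q by fact
  have "finite_measure Q" by unfold_locales
  from P.real_RN_deriv[OF this ac] obtain D
    where D: "D \<in> borel_measurable P" "AE x in P. RN_deriv P Q x = ennreal (D x)" "\<And>x. 0 \<le> D x"
    by metis
  have "Q = density P (RN_deriv P Q)"
    using ac by (rule P.density_RN_deriv[symmetric])
  also have "\<dots> = density P D"
    using D by (auto intro!: density_cong)
  finally have QD: "Q = density P D" .
  show ?thesis
  proof (cases "integrable P (\<lambda>x. D x * log b (D x))")
    case True
    then show ?thesis
      using P.KL_nonneg[of D] D Q unfolding QD by auto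
  next
    case False
    then show ?thesis
      using D \<open>1 < b\<close> unfolding QD by (subst P.KL_density) (auto simp: not_integrable_integral_eq)
  qed
qed

lemma absolutely_continuous_distr:
  assumes "absolutely_continuous P Q" "sets Q = sets P" and f: "f \<in> measurable P N"
  shows "absolutely_continuous (distr P N f) (distr Q N f)"
proof -
  have f': "f \<in> measurable Q N"
    using f by (simp add: assms(2) cong: measurable_cong_sets)
  have "space Q = space P" by (rule sets_eq_imp_space_eq) fact
  then show ?thesis
    using assms(1) f f' unfolding absolutely_continuous_def
    by (auto simp: null_sets_distr_iff)
qed

context information_space
begin

lemma mutual_information_nonneg_ac:
  assumes [measurable]: "X \<in> measurable M S" "Y \<in> measurable M T"
    and ac: "absolutely_continuous (distr M S X \<Otimes>\<^sub>M distr M T Y) (distr M (S \<Otimes>\<^sub>M T) (\<lambda>w. (X w, Y w)))"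
  shows "0 \<le> mutual_information b S T X Y"
  unfolding mutual_information_def
proof (rule KL_divergence_nonneg_ac[OF b_gt_1])
  interpret X: prob_space "distr M S X" by (rule prob_space_distr) simp
  interpret Y: prob_space "distr M T Y" by (rule prob_space_distr) simp
  interpret XY: pair_prob_space "distr M S X" "distr M T Y" ..
  show "prob_space (distr M S X \<Otimes>\<^sub>M distr M T Y)" by unfold_locales
  show "prob_space (distr M (S \<Otimes>\<^sub>M T) (\<lambda>w. (X w, Y w)))"
    by (rule prob_space_distr) simp
  show "sets (distr M (S \<Otimes>\<^sub>M T) (\<lambda>w. (X w, Y w))) = sets (distr M S X \<Otimes>\<^sub>M distr M T Y)"
    by (simp add: sets_pair_measure)
qed fact

text \<open>Absolute continuity survives the application of \<open>\<phi>\<close> to the second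
  component. With a projection as \<open>\<phi>\<close>, this makes the term subtracted in a
  conditional mutual information nonnegative, although densities are at hand only for the full
  input.\<close>

lemma mutual_information_comp_nonneg:
  assumes [measurable]: "X \<in> measurable M S" "Y \<in> measurable M T" "\<phi> \<in> measurable S S'"
    and ac: "absolutely_continuous (distr M T Y \<Otimes>\<^sub>M distr M S X) (distr M (T \<Otimes>\<^sub>M S) (\<lambda>w. (Y w, X w)))"
  shows "0 \<le> mutual_information b T S' Y (\<lambda>w. \<phi> (X w))"
proof (rule mutual_information_nonneg_ac)
  interpret Y: prob_space "distr M T Y" by (rule prob_space_distr) simp
  interpret X: prob_space "distr (distr M S X) S' \<phi>"
    by (intro prob_space.prob_space_distr prob_space_distr) simp_all
  let ?f = "\<lambda>(y, x). (y, \<phi> x)"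
  have f[measurable]: "?f \<in> measurable (T \<Otimes>\<^sub>M S) (T \<Otimes>\<^sub>M S')" by measurable
  have "distr (distr M T Y) T (\<lambda>x. x) \<Otimes>\<^sub>M distr (distr M S X) S' \<phi>
     = distr (distr M T Y \<Otimes>\<^sub>M distr M S X) (T \<Otimes>\<^sub>M S') ?f"
    by (rule pair_measure_distr) (simp_all, unfold_locales)
  moreover have "distr (distr M T Y) T (\<lambda>x. x) = distr M T Y" by (simp add: distr_distr comp_def)
  moreover have "distr (distr M S X) S' \<phi> = distr M S' (\<lambda>w. \<phi> (X w))"
    by (simp add: distr_distr comp_def)
  moreover have "distr (distr M (T \<Otimes>\<^sub>M S) (\<lambda>w. (Y w, X w))) (T \<Otimes>\<^sub>M S') ?f
    = distr M (T \<Otimes>\<^sub>M S') (\<lambda>w. (Y w, \<phi> (X w)))"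
    by (subst distr_distr) (simp_all add: comp_def)
  moreover have "absolutely_continuous
      (distr (distr M T Y \<Otimes>\<^sub>M distr M S X) (T \<Otimes>\<^sub>M S') ?f)
      (distr (distr M (T \<Otimes>\<^sub>M S) (\<lambda>w. (Y w, X w))) (T \<Otimes>\<^sub>M S') ?f)"
    by (rule absolutely_continuous_distr[OF ac]) (simp_all add: sets_pair_measure)
  ultimately show "absolutely_continuous (distr M T Y \<Otimes>\<^sub>M distr M S' (\<lambda>w. \<phi> (X w)))
       (distr M (T \<Otimes>\<^sub>M S') (\<lambda>w. (Y w, \<phi> (X w))))"
    by simp
qed simp_all

end

text \<open>
  \<open>k (x, y)\<close> is the conditional density of \<open>Y\<close> given \<open>X = x\<close>, and \<open>p\<close> the density of \<open>Y\<close>.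
\<close>

locale channel = information_space M b for M :: "'a measure" and b :: real +
  fixes S :: "'b measure" and X :: "'a \<Rightarrow> 'b" and Y :: "'a \<Rightarrow> 'c::euclidean_space"
    and k :: "'b \<times> 'c \<Rightarrow> real" and p :: "'c \<Rightarrow> real"
  assumes joint: "distributed M (distr M S X \<Otimes>\<^sub>M lborel) (\<lambda>w. (X w, Y w)) (\<lambda>z. ennreal (k z))"
    and marginal: "distributed M lborel Y (\<lambda>y. ennreal (p y))"
    and X_measurable [measurable]: "X \<in> measurable M S"
    and k_pos: "\<And>z. 0 < k z" and p_pos: "\<And>y. 0 < p y"
begin

lemma Y_measurable [measurable]: "Y \<in> borel_measurable M"
  using distributed_measurable[OF marginal] by simp

lemma p_measurable [measurable]: "p \<in> borel_measurable borel"
  using distributed_real_measurable[OF _ marginal] p_pos by (simp add: less_imp_le)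

lemma k_measurable_distr: "k \<in> borel_measurable (distr M S X \<Otimes>\<^sub>M lborel)"
  by (rule distributed_real_measurable[OF _ joint]) (simp add: k_pos less_imp_le)

lemma k_measurable [measurable]: "k \<in> borel_measurable (S \<Otimes>\<^sub>M borel)"
proof -
  have "sets (distr M S X \<Otimes>\<^sub>M (lborel :: 'c measure)) = sets (S \<Otimes>\<^sub>M borel)"
    by (intro sets_pair_measure_cong) simp_all
  then show ?thesis using k_measurable_distr by (simp cong: measurable_cong_sets)
qed

lemma sigma_finite_X: "sigma_finite_measure (distr M S X)"
proof -
  interpret X: prob_space "distr M S X" by (rule prob_space_distr) simp
  show ?thesis by unfold_locales
qed

text \<open>With the law of \<open>X\<close> itself as reference measure, \<open>X\<close> has
  density 1 and the joint density is the conditional density \<open>k\<close>; this covers discrete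
  and singular inputs alike. Both orders of the arguments occur: the output comes second in
  \<open>I(X1,X2;Y3)\<close> and first in the conditional terms.\<close>

lemma mutual_information_eq:
  "mutual_information b S borel X Y = expectation (\<lambda>w. log b (k (X w, Y w) / p (Y w)))" (is ?A)
  "mutual_information b borel S Y X = expectation (\<lambda>w. log b (k (X w, Y w) / p (Y w)))" (is ?B)
proof -
  let ?F = "distr M S X"
  interpret F: sigma_finite_measure ?F by (rule sigma_finite_X)
  note [measurable] = k_measurable_distr
  have F: "distr M ?F X = ?F"
    by (rule distr_cong) simp_all
  have L: "distr M lborel Y = distr M borel Y"
    by (rule distr_cong) simp_all
  have X: "distributed M ?F X (\<lambda>x. ennreal 1)"
    by (simp add: distributed_def F density_1)
  have FL: "distr M (?F \<Otimes>\<^sub>M lborel) (\<lambda>w. (X w, Y w)) = distr M (S \<Otimes>\<^sub>M borel) (\<lambda>w. (X w, Y w))"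
    by (intro distr_cong sets_pair_measure_cong) simp_all
  have LF: "distr M (lborel \<Otimes>\<^sub>M ?F) (\<lambda>w. (Y w, X w)) = distr M (borel \<Otimes>\<^sub>M S) (\<lambda>w. (Y w, X w))"
    by (intro distr_cong sets_pair_measure_cong) simp_all
  have "mutual_information b S borel X Y = mutual_information b ?F lborel X Y"
    by (simp add: mutual_information_def F L FL)
  also have "\<dots> = (\<integral>z. k z * log b (k z / (1 * p (snd z))) \<partial>(?F \<Otimes>\<^sub>M lborel))"
    by (rule mutual_information_distr[OF _ _ X _ marginal _ joint])
       (auto simp: k_pos p_pos less_imp_le, unfold_locales)
  also have "\<dots> = expectation (\<lambda>w. log b (k (X w, Y w) / (1 * p (snd (X w, Y w)))))"
    by (rule distributed_integral[OF joint]) (simp_all add: k_pos less_imp_le)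
  finally show ?A by simp
  have swap: "distributed M (lborel \<Otimes>\<^sub>M ?F) (\<lambda>w. (Y w, X w)) (\<lambda>z. ennreal ((\<lambda>(y, x). k (x, y)) z))"
    using distributed_swap[OF sigma_finite_X sigma_finite_lborel joint] by (simp add: case_prod_unfold)
  have "mutual_information b borel S Y X = mutual_information b lborel ?F Y X"
    by (simp add: mutual_information_def F L LF)
  also have "\<dots> = (\<integral>z. (\<lambda>(y, x). k (x, y)) z * log b ((\<lambda>(y, x). k (x, y)) z / (p (fst z) * 1))
      \<partial>(lborel \<Otimes>\<^sub>M ?F))"
    by (rule mutual_information_distr[OF _ _ marginal _ X _ swap])
       (auto simp: k_pos p_pos less_imp_le, unfold_locales)
  also have "\<dots> = expectation (\<lambda>w. log b ((\<lambda>(y, x). k (x, y)) (Y w, X w) / (p (fst (Y w, X w)) * 1)))"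
    by (rule distributed_integral[OF swap]) (simp_all add: k_pos less_imp_le case_prod_unfold)
  finally show ?B by simp
qed

text \<open>Since \<open>p\<close> is positive, the product of the marginals has the same null sets
  as Lebesgue measure times the law of \<open>X\<close>, and with respect to the latter the joint
  law has a density.\<close>

lemma absolutely_continuous_joint:
  "absolutely_continuous (distr M borel Y \<Otimes>\<^sub>M distr M S X) (distr M (borel \<Otimes>\<^sub>M S) (\<lambda>w. (Y w, X w)))"
proof -
  let ?F = "distr M S X"
  interpret F: prob_space ?F by (rule prob_space_distr) simp
  note [measurable] = k_measurable_distr
  have swap: "distributed M (lborel \<Otimes>\<^sub>M ?F) (\<lambda>w. (Y w, X w)) (\<lambda>z. ennreal ((\<lambda>(y, x). k (x, y)) z))"
    using distributed_swap[OF sigma_finite_X sigma_finite_lborel joint] by (simp add: case_prod_unfold)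
  have "distr M (borel \<Otimes>\<^sub>M S) (\<lambda>w. (Y w, X w)) = distr M (lborel \<Otimes>\<^sub>M ?F) (\<lambda>w. (Y w, X w))"
    by (intro distr_cong sets_pair_measure_cong) simp_all
  also have "\<dots> = density (lborel \<Otimes>\<^sub>M ?F) (\<lambda>z. ennreal ((\<lambda>(y, x). k (x, y)) z))"
    by (rule distributed_distr_eq_density[OF swap])
  finally have YX: "distr M (borel \<Otimes>\<^sub>M S) (\<lambda>w. (Y w, X w))
    = density (lborel \<Otimes>\<^sub>M ?F) (\<lambda>z. ennreal ((\<lambda>(y, x). k (x, y)) z))" .
  have "distr M borel Y = distr M lborel Y" by (rule distr_cong) simp_all
  also have "\<dots> = density lborel (\<lambda>y. ennreal (p y))"
    by (rule distributed_distr_eq_density[OF marginal])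
  finally have "distr M borel Y \<Otimes>\<^sub>M ?F = density lborel (\<lambda>y. ennreal (p y)) \<Otimes>\<^sub>M density ?F (\<lambda>_. 1)"
    by (simp add: density_1)
  also have "\<dots> = density (lborel \<Otimes>\<^sub>M ?F) (\<lambda>(y, x). ennreal (p y) * 1)"
    by (rule pair_measure_density) (simp_all add: density_1, unfold_locales)
  finally have "distr M borel Y \<Otimes>\<^sub>M ?F = density (lborel \<Otimes>\<^sub>M ?F) (\<lambda>z. ennreal (p (fst z)))"
    by (simp add: case_prod_unfold)
  moreover have "ennreal (p y) \<noteq> 0" for y
    using p_pos[of y] by (simp add: not_le)
  ultimately show ?thesis
    unfolding YX absolutely_continuous_def
    by (auto simp: null_sets_density_iff case_prod_unfold)
qed

text \<open>
  Both directions come from \<open>ln t \<le> t - 1\<close>: the variables \<open>q (Y) / p (Y)\<close> and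
  \<open>p (Y) / k (X, Y)\<close> have expectation at most \<open>1\<close>.
\<close>

lemma expectation_ln_ratio_le:
  assumes [measurable]: "q \<in> borel_measurable borel" and q: "\<And>y. 0 < q y"
    and q1: "(\<integral>\<^sup>+ y. ennreal (q y) \<partial>lborel) \<le> 1"
    and int: "integrable M (\<lambda>w. ln (k (X w, Y w) / q (Y w)))"
  shows "integrable M (\<lambda>w. ln (k (X w, Y w) / p (Y w)))"
    and "expectation (\<lambda>w. ln (k (X w, Y w) / p (Y w))) \<le> expectation (\<lambda>w. ln (k (X w, Y w) / q (Y w)))"
proof -
  let ?F = "distr M S X"
  interpret F: prob_space ?F by (rule prob_space_distr) simp
  note [measurable] = k_measurable_distr
  have "(\<integral>\<^sup>+ w. ennreal (q (Y w) / p (Y w)) \<partial>M) = (\<integral>\<^sup>+ y. ennreal (p y) * ennreal (q y / p y) \<partial>lborel)"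
    by (rule distributed_nn_integral[OF marginal, symmetric]) simp
  also have "\<dots> = (\<integral>\<^sup>+ y. ennreal (q y) \<partial>lborel)"
    using p_pos q
    by (intro nn_integral_cong) (simp add: ennreal_mult[symmetric] less_imp_le less_imp_neq[THEN not_sym])
  finally have A: "(\<integral>\<^sup>+ w. ennreal (q (Y w) / p (Y w)) \<partial>M) \<le> 1" using q1 by simp
  have iA: "integrable M (\<lambda>w. q (Y w) / p (Y w))"
    using A p_pos q by (intro integrableI_nonneg) (auto simp: less_imp_le intro: le_less_trans)
  have "ennreal (expectation (\<lambda>w. q (Y w) / p (Y w))) \<le> 1"
    using A p_pos q iA by (subst nn_integral_eq_integral[symmetric]) (auto simp: less_imp_le)
  then have eA: "expectation (\<lambda>w. q (Y w) / p (Y w)) \<le> 1" by simp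
  have "(\<integral>\<^sup>+ w. ennreal (p (Y w) / k (X w, Y w)) \<partial>M)
    = (\<integral>\<^sup>+ w. (\<lambda>z. ennreal (p (snd z) / k z)) (X w, Y w) \<partial>M)" by simp
  also have "\<dots> = (\<integral>\<^sup>+ z. ennreal (k z) * ennreal (p (snd z) / k z) \<partial>(?F \<Otimes>\<^sub>M lborel))"
    by (rule distributed_nn_integral[OF joint, symmetric]) simp
  also have "\<dots> = (\<integral>\<^sup>+ z. ennreal (p (snd z)) \<partial>(?F \<Otimes>\<^sub>M lborel))"
    using p_pos k_pos
    by (intro nn_integral_cong) (simp add: ennreal_mult[symmetric] less_imp_le less_imp_neq[THEN not_sym])
  also have "\<dots> = (\<integral>\<^sup>+ x. \<integral>\<^sup>+ y. ennreal (p (snd (x, y))) \<partial>lborel \<partial>?F)"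
    by (rule lborel.nn_integral_fst[symmetric]) simp
  also have "\<dots> = (\<integral>\<^sup>+ y. ennreal (p y) \<partial>lborel)"
    by (simp add: F.emeasure_space_1[simplified])
  also have "\<dots> = (\<integral>\<^sup>+ y. ennreal (p y) * 1 \<partial>lborel)" by simp
  also have "\<dots> = (\<integral>\<^sup>+ w. 1 \<partial>M)"
    by (rule distributed_nn_integral[OF marginal]) simp
  finally have B: "(\<integral>\<^sup>+ w. ennreal (p (Y w) / k (X w, Y w)) \<partial>M) = 1"
    by (simp add: emeasure_space_1)
  have iB: "integrable M (\<lambda>w. p (Y w) / k (X w, Y w))"
    using B p_pos k_pos by (intro integrableI_nonneg) (auto simp: less_imp_le)
  have up: "ln (k (x, y) / p y) \<le> ln (k (x, y) / q y) + (q y / p y - 1)" for x y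
  proof -
    have "ln (k (x, y) / p y) = ln (k (x, y) / q y) + ln (q y / p y)"
      using p_pos[of y] k_pos[of "(x, y)"] q[of y] by (simp add: ln_div)
    then show ?thesis
      using p_pos[of y] q[of y] ln_le_minus_one[of "q y / p y"] by simp
  qed
  have lo: "- (p y / k (x, y)) \<le> ln (k (x, y) / p y)" for x y
  proof -
    have "ln (k (x, y) / p y) = - ln (p y / k (x, y))"
      using p_pos[of y] k_pos[of "(x, y)"] by (simp add: ln_div)
    then show ?thesis
      using p_pos[of y] k_pos[of "(x, y)"] ln_le_minus_one[of "p y / k (x, y)"] by simp
  qed
  show i: "integrable M (\<lambda>w. ln (k (X w, Y w) / p (Y w)))"
  proof (rule Bochner_Integration.integrable_bound)
    show "integrable M (\<lambda>w. \<bar>ln (k (X w, Y w) / q (Y w))\<bar> + (q (Y w) / p (Y w) + (p (Y w) / k (X w, Y w) + 1)))"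
      using int iA iB by simp
    have "\<bar>ln (k (x, y) / p y)\<bar> \<le> \<bar>ln (k (x, y) / q y)\<bar> + (q y / p y + (p y / k (x, y) + 1))" for x y
      using up[of x y] lo[of y x] divide_pos_pos[OF q[of y] p_pos[of y]]
        divide_pos_pos[OF p_pos[of y] k_pos[of "(x, y)"]] by linarith
    then show "AE w in M. norm (ln (k (X w, Y w) / p (Y w)))
      \<le> norm (\<bar>ln (k (X w, Y w) / q (Y w))\<bar> + (q (Y w) / p (Y w) + (p (Y w) / k (X w, Y w) + 1)))"
      by (intro AE_I2) (metis abs_ge_self order_trans real_norm_def)
  qed measurable
  have "expectation (\<lambda>w. ln (k (X w, Y w) / p (Y w)))
    \<le> expectation (\<lambda>w. ln (k (X w, Y w) / q (Y w)) + (q (Y w) / p (Y w) - 1))"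
    using i int iA up by (intro integral_mono) simp_all
  also have "\<dots> = expectation (\<lambda>w. ln (k (X w, Y w) / q (Y w))) + (expectation (\<lambda>w. q (Y w) / p (Y w)) - 1)"
    using int iA by (simp add: prob_space)
  finally show "expectation (\<lambda>w. ln (k (X w, Y w) / p (Y w))) \<le> expectation (\<lambda>w. ln (k (X w, Y w) / q (Y w)))"
    using eA by simp
qed

lemma mutual_information_le:
  assumes "q \<in> borel_measurable borel" "\<And>y. 0 < q y" "(\<integral>\<^sup>+ y. ennreal (q y) \<partial>lborel) \<le> 1"
    and "integrable M (\<lambda>w. ln (k (X w, Y w) / q (Y w)))"
    and le: "expectation (\<lambda>w. ln (k (X w, Y w) / q (Y w))) \<le> C"
  shows "mutual_information b S borel X Y \<le> C / ln b" "mutual_information b borel S Y X \<le> C / ln b"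
  unfolding mutual_information_eq log_def
  using order_trans[OF expectation_ln_ratio_le(2)[OF assms(1-4)] le] b_gt_1
  by (auto intro!: divide_right_mono)

text \<open>A ceiling \<open>B\<close> on the output density is a floor \<open>- ln B\<close> on the
  differential entropy of the output; the mean of \<open>ln k\<close> is minus the conditional
  entropy.\<close>

lemma mutual_information_ge:
  assumes int: "integrable M (\<lambda>w. ln (k (X w, Y w) / p (Y w)))"
    and ik: "integrable M (\<lambda>w. ln (k (X w, Y w)))" and le: "\<And>y. p y \<le> B"
  shows "(expectation (\<lambda>w. ln (k (X w, Y w))) - ln B) / ln b \<le> mutual_information b S borel X Y"
    and "(expectation (\<lambda>w. ln (k (X w, Y w))) - ln B) / ln b \<le> mutual_information b borel S Y X"
proof -
  have "expectation (\<lambda>w. ln (k (X w, Y w))) - ln B = expectation (\<lambda>w. ln (k (X w, Y w)) - ln B)"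
    using ik by (simp add: prob_space)
  also have "\<dots> \<le> expectation (\<lambda>w. ln (k (X w, Y w) / p (Y w)))"
  proof (intro integral_mono)
    show "ln (k (X w, Y w)) - ln B \<le> ln (k (X w, Y w) / p (Y w))" for w
      using k_pos[of "(X w, Y w)"] p_pos[of "Y w"] le[of "Y w"] by (simp add: ln_div)
  qed (use ik int in simp_all)
  finally show "(expectation (\<lambda>w. ln (k (X w, Y w))) - ln B) / ln b \<le> mutual_information b S borel X Y"
    "(expectation (\<lambda>w. ln (k (X w, Y w))) - ln B) / ln b \<le> mutual_information b borel S Y X"
    unfolding mutual_information_eq log_def using b_gt_1 by (auto intro!: divide_right_mono)
qed

text \<open>The output density \<open>p\<close> cancels in the difference of the two log ratios, so
  the conditional density \<open>k'\<close> given \<open>X'\<close> takes over the role that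
  \<open>p\<close> has in the unconditional bound.\<close>

lemma mutual_information_diff_ge:
  assumes int: "integrable M (\<lambda>w. ln (k (X w, Y w) / p (Y w)))"
    and ik: "integrable M (\<lambda>w. ln (k (X w, Y w)))" and le: "\<And>y. p y \<le> B"
    and ch: "channel M b S' X' Y k' p" and le': "\<And>z. k' z \<le> B"
  shows "(expectation (\<lambda>w. ln (k (X w, Y w))) - ln B) / ln b
    \<le> mutual_information b borel S Y X - mutual_information b borel S' Y X'"
proof -
  interpret c: channel M b S' X' Y k' p by fact
  show ?thesis
  proof (cases "integrable M (\<lambda>w. ln (k' (X' w, Y w) / p (Y w)))")
    \<comment> \<open>The subtracted information is 0 by convention here, and the bound on
      \<open>p\<close> gives the same estimate for the first term alone.\<close>
    case False
    have "\<not> integrable M (\<lambda>w. log b (k' (X' w, Y w) / p (Y w)))"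
    proof
      assume "integrable M (\<lambda>w. log b (k' (X' w, Y w) / p (Y w)))"
      then have "integrable M (\<lambda>w. ln b * log b (k' (X' w, Y w) / p (Y w)))" by simp
      then show False using False b_gt_1 by (simp add: log_def)
    qed
    then have "mutual_information b borel S' Y X' = 0"
      unfolding c.mutual_information_eq by (rule not_integrable_integral_eq)
    then show ?thesis using mutual_information_ge(2)[OF int ik le] by simp
  next
    case True
    have "expectation (\<lambda>w. ln (k (X w, Y w))) - ln B = expectation (\<lambda>w. ln (k (X w, Y w)) - ln B)"
      using ik by (simp add: prob_space)
    also have "\<dots> \<le> expectation (\<lambda>w. ln (k (X w, Y w) / p (Y w)) - ln (k' (X' w, Y w) / p (Y w)))"
    proof (intro integral_mono)
      show "ln (k (X w, Y w)) - ln B \<le> ln (k (X w, Y w) / p (Y w)) - ln (k' (X' w, Y w) / p (Y w))" for w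
        using k_pos[of "(X w, Y w)"] p_pos[of "Y w"] c.k_pos[of "(X' w, Y w)"] le'[of "(X' w, Y w)"]
        by (simp add: ln_div)
    qed (use ik int True in simp_all)
    also have "\<dots> = expectation (\<lambda>w. ln (k (X w, Y w) / p (Y w)))
        - expectation (\<lambda>w. ln (k' (X' w, Y w) / p (Y w)))"
      using int True by simp
    finally show ?thesis
      unfolding mutual_information_eq c.mutual_information_eq log_def
      using b_gt_1 by (simp add: divide_right_mono diff_divide_distrib[symmetric])
  qed
qed

end

subsection \<open>Outputs with additive Gaussian noise\<close>

lemma distr_pair_snd:
  assumes "prob_space F" "sigma_finite_measure N"
  shows "distr (F \<Otimes>\<^sub>M N) N snd = N"
proof (rule measure_eqI)
  interpret F: prob_space F by fact
  interpret N: sigma_finite_measure N by fact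
  fix A assume "A \<in> sets (distr (F \<Otimes>\<^sub>M N) N snd)"
  then have A: "A \<in> sets N" by simp
  then have "snd -` A \<inter> space (F \<Otimes>\<^sub>M N) = space F \<times> A"
    by (auto simp: space_pair_measure dest: sets.sets_into_space)
  with A show "emeasure (distr (F \<Otimes>\<^sub>M N) N snd) A = emeasure N A"
    by (simp add: emeasure_distr N.emeasure_pair_measure_Times F.emeasure_space_1)
qed simp

lemma nn_integral_lborel_translate:
  fixes t :: "'a::euclidean_space"
  assumes [measurable]: "g \<in> borel_measurable borel"
  shows "(\<integral>\<^sup>+ z. g (t + z) \<partial>lborel) = (\<integral>\<^sup>+ y. g y \<partial>lborel)"
proof -
  have "(\<integral>\<^sup>+ y. g y \<partial>lborel) = (\<integral>\<^sup>+ y. g y \<partial>distr lborel borel ((+) t))"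
    by (simp add: lborel_distr_plus)
  also have "\<dots> = (\<integral>\<^sup>+ z. g (t + z) \<partial>lborel)"
    by (subst nn_integral_distr) simp_all
  finally show ?thesis by simp
qed

abbreviation noise_power :: "'n::finite itself \<Rightarrow> real" where
  "noise_power _ \<equiv> (\<integral>z. (norm z)\<^sup>2 \<partial>(CN :: (complex ^ 'n) measure))"

text \<open>The relay channel draws both noise vectors from one product space \<open>N\<close>, and
  \<open>\<zeta>\<close> picks the one that belongs to the output in question. For direct
  transmission \<open>\<zeta>\<close> is the identity.\<close>

locale gaussian_output = F: prob_space F + N: prob_space N
  for F :: "'x measure" and N :: "'z measure" +
  fixes \<zeta> :: "'z \<Rightarrow> complex ^ 'n::finite" and h :: "'x \<Rightarrow> complex ^ 'n"
  assumes noise_measurable [measurable]: "\<zeta> \<in> borel_measurable N"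
    and noise: "distr N borel \<zeta> = CN"
    and h_measurable [measurable]: "h \<in> borel_measurable F"
begin

abbreviation "M \<equiv> F \<Otimes>\<^sub>M N"
abbreviation "Y \<equiv> (\<lambda>w. h (fst w) + \<zeta> (snd w))"

sublocale FN: pair_prob_space F N ..

definition "p y = (\<integral>x. cn_density (y - h x) \<partial>F)"

lemma ennreal_p: "ennreal (p y) = (\<integral>\<^sup>+ x. ennreal (cn_density (y - h x)) \<partial>F)"
  unfolding p_def
  by (intro nn_integral_eq_integral[symmetric] F.integrable_const_bound[where B = 1])
     (auto simp: cn_density_le_1)

lemma p_pos: "0 < p y"
  unfolding p_def
  by (intro F.expectation_greater F.integrable_const_bound[where B = 1])
     (auto simp: cn_density_le_1)

lemma p_measurable [measurable]: "p \<in> borel_measurable borel"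
  unfolding p_def[abs_def] by measurable

lemma nn_integral_output:
  assumes G[measurable]: "G \<in> borel_measurable (F \<Otimes>\<^sub>M borel)"
  shows "(\<integral>\<^sup>+ w. G (fst w, Y w) \<partial>M) = (\<integral>\<^sup>+ x. \<integral>\<^sup>+ y. ennreal (cn_density (y - h x)) * G (x, y) \<partial>lborel \<partial>F)"
proof -
  have "(\<integral>\<^sup>+ w. G (fst w, Y w) \<partial>M) = (\<integral>\<^sup>+ x. \<integral>\<^sup>+ n. G (x, h x + \<zeta> n) \<partial>N \<partial>F)"
    by (subst N.nn_integral_fst[symmetric]) simp_all
  also have "\<dots> = (\<integral>\<^sup>+ x. \<integral>\<^sup>+ y. ennreal (cn_density (y - h x)) * G (x, y) \<partial>lborel \<partial>F)"
  proof (rule nn_integral_cong)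
    fix x assume [measurable]: "x \<in> space F"
    have "(\<integral>\<^sup>+ n. G (x, h x + \<zeta> n) \<partial>N) = (\<integral>\<^sup>+ z. G (x, h x + z) \<partial>CN)"
      unfolding noise[symmetric] by (subst nn_integral_distr) simp_all
    also have "\<dots> = (\<integral>\<^sup>+ z. ennreal (cn_density z) * G (x, h x + z) \<partial>lborel)"
      by (rule nn_integral_CN) simp
    also have "\<dots> = (\<integral>\<^sup>+ z. (\<lambda>y. ennreal (cn_density (y - h x)) * G (x, y)) (h x + z) \<partial>lborel)"
      by simp
    also have "\<dots> = (\<integral>\<^sup>+ y. ennreal (cn_density (y - h x)) * G (x, y) \<partial>lborel)"
      by (rule nn_integral_lborel_translate) simp
    finally show "(\<integral>\<^sup>+ n. G (x, h x + \<zeta> n) \<partial>N)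
      = (\<integral>\<^sup>+ y. ennreal (cn_density (y - h x)) * G (x, y) \<partial>lborel)" .
  qed
  finally show ?thesis .
qed

lemma distributed_output: "distributed M lborel Y (\<lambda>y. ennreal (p y))"
  unfolding distributed_def
proof (intro conjI measure_eqI)
  interpret FL: pair_sigma_finite F "lborel :: (complex ^ 'n) measure" ..
  fix A assume "A \<in> sets (distr M lborel Y)"
  then have [measurable]: "A \<in> sets borel" by simp
  have "emeasure (distr M lborel Y) A = (\<integral>\<^sup>+ w. (\<lambda>(x, y). indicator A y) (fst w, Y w) \<partial>M)"
    by (simp add: nn_integral_indicator[symmetric] nn_integral_distr del: nn_integral_indicator)
  also have "\<dots> = (\<integral>\<^sup>+ x. \<integral>\<^sup>+ y. ennreal (cn_density (y - h x)) * indicator A y \<partial>lborel \<partial>F)"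
    by (subst nn_integral_output) simp_all
  also have "\<dots> = (\<integral>\<^sup>+ y. \<integral>\<^sup>+ x. ennreal (cn_density (y - h x)) * indicator A y \<partial>F \<partial>lborel)"
    by (rule FL.Fubini'[symmetric]) simp
  also have "\<dots> = (\<integral>\<^sup>+ y. ennreal (p y) * indicator A y \<partial>lborel)"
    by (simp add: nn_integral_multc ennreal_p)
  also have "\<dots> = emeasure (density lborel (\<lambda>y. ennreal (p y))) A"
    by (simp add: emeasure_density)
  finally show "emeasure (distr M lborel Y) A = emeasure (density lborel (\<lambda>y. ennreal (p y))) A" .
qed simp_all

end

text \<open>
  \<open>H (v, \<cdot>)\<close> under \<open>R\<close> is the conditional law of the noiseless output \<open>h\<close> given \<open>V = v\<close>.
\<close>

locale gaussian_mixture = gaussian_output F N \<zeta> h + R: prob_space R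
  for F :: "'x measure" and N :: "'z measure" and \<zeta> :: "'z \<Rightarrow> complex ^ 'n::finite"
    and h :: "'x \<Rightarrow> complex ^ 'n" and R :: "'r measure" +
  fixes S :: "'v measure" and V :: "'x \<Rightarrow> 'v" and H :: "'v \<times> 'r \<Rightarrow> complex ^ 'n"
  assumes V_measurable [measurable]: "V \<in> measurable F S"
    and H_measurable [measurable]: "H \<in> borel_measurable (S \<Otimes>\<^sub>M R)"
    and H_section [measurable]: "\<And>v. (\<lambda>r. H (v, r)) \<in> borel_measurable R"
    and law: "\<And>G :: 'v \<times> (complex ^ 'n) \<Rightarrow> ennreal. G \<in> borel_measurable (S \<Otimes>\<^sub>M borel) \<Longrightarrow>
      (\<integral>\<^sup>+ x. G (V x, h x) \<partial>F) = (\<integral>\<^sup>+ x. \<integral>\<^sup>+ r. G (V x, H (V x, r)) \<partial>R \<partial>F)"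
begin

definition "k z = (\<integral>r. cn_density (snd z - H (fst z, r)) \<partial>R)"

lemma ennreal_k: "ennreal (k z) = (\<integral>\<^sup>+ r. ennreal (cn_density (snd z - H (fst z, r))) \<partial>R)"
  unfolding k_def
  by (intro nn_integral_eq_integral[symmetric] R.integrable_const_bound[where B = 1])
     (auto simp: cn_density_le_1)

lemma k_pos: "0 < k z"
  unfolding k_def
  by (intro R.expectation_greater R.integrable_const_bound[where B = 1])
     (auto simp: cn_density_le_1)

lemma distr_V: "distr M S (\<lambda>w. V (fst w)) = distr F S V"
proof -
  have "distr M S (\<lambda>w. V (fst w)) = distr (distr M F fst) S V"
    by (simp add: distr_distr comp_def)
  then show ?thesis by (simp add: N.distr_pair_fst)
qed

sublocale V: prob_space "distr F S V"
  by (rule F.prob_space_distr) simp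

lemma nn_integral_V_h:
  assumes [measurable]: "G \<in> borel_measurable (S \<Otimes>\<^sub>M borel)"
  shows "(\<integral>\<^sup>+ x. G (V x, h x) \<partial>F) = (\<integral>\<^sup>+ v. \<integral>\<^sup>+ r. G (v, H (v, r)) \<partial>R \<partial>distr F S V)"
  using law[of G] by (simp add: nn_integral_distr)

text \<open>The output density is the average of the conditional densities \<open>k (v, y)\<close>
  over the law of \<open>V\<close>, so it inherits every uniform bound on them.\<close>

lemma p_le:
  assumes "\<And>z. k z \<le> B"
  shows "p y \<le> B"
proof -
  have B: "0 \<le> B" using assms[of undefined] k_pos[of undefined] by linarith
  have "ennreal (p y) = (\<integral>\<^sup>+ v. \<integral>\<^sup>+ r. ennreal (cn_density (y - H (v, r))) \<partial>R \<partial>distr F S V)"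
    using nn_integral_V_h[of "\<lambda>z. ennreal (cn_density (y - snd z))"] by (simp add: ennreal_p)
  also have "\<dots> = (\<integral>\<^sup>+ v. ennreal (k (v, y)) \<partial>distr F S V)"
    by (simp add: ennreal_k)
  also have "\<dots> \<le> (\<integral>\<^sup>+ v. ennreal B \<partial>distr F S V)"
    by (intro nn_integral_mono ennreal_leI assms)
  also have "\<dots> = ennreal B" using V.emeasure_space_1 by simp
  finally show ?thesis using B by simp
qed

lemma distributed_joint:
  "distributed M (distr M S (\<lambda>w. V (fst w)) \<Otimes>\<^sub>M lborel) (\<lambda>w. (V (fst w), Y w)) (\<lambda>z. ennreal (k z))"
  unfolding distributed_def distr_V
proof (intro conjI measure_eqI)
  interpret RL: pair_sigma_finite R "lborel :: (complex ^ 'n) measure" ..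
  show m[measurable]: "(\<lambda>z. ennreal (k z)) \<in> borel_measurable (distr F S V \<Otimes>\<^sub>M lborel)"
    unfolding k_def[abs_def] by measurable
  show YM: "(\<lambda>w. (V (fst w), Y w)) \<in> measurable M (distr F S V \<Otimes>\<^sub>M lborel)" by measurable
  fix A assume "A \<in> sets (distr M (distr F S V \<Otimes>\<^sub>M lborel) (\<lambda>w. (V (fst w), Y w)))"
  then have A: "A \<in> sets (distr F S V \<Otimes>\<^sub>M (lborel :: (complex ^ 'n) measure))" by simp
  have eq: "sets (distr F S V \<Otimes>\<^sub>M (lborel :: (complex ^ 'n) measure)) = sets (S \<Otimes>\<^sub>M borel)"
    by (intro sets_pair_measure_cong) simp_all
  have A'[measurable]: "A \<in> sets (S \<Otimes>\<^sub>M borel)" using A unfolding eq .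
  have "emeasure (distr M (distr F S V \<Otimes>\<^sub>M lborel) (\<lambda>w. (V (fst w), Y w))) A
      = (\<integral>\<^sup>+ z. indicator A z \<partial>distr M (distr F S V \<Otimes>\<^sub>M lborel) (\<lambda>w. (V (fst w), Y w)))"
    using A by simp
  also have "\<dots> = (\<integral>\<^sup>+ w. indicator A (V (fst w), Y w) \<partial>M)"
    using A by (subst nn_integral_distr[OF YM]) simp_all
  also have "\<dots> = (\<integral>\<^sup>+ w. (\<lambda>z. indicator A (V (fst z), snd z)) (fst w, Y w) \<partial>M)" by simp
  also have "\<dots> = (\<integral>\<^sup>+ x. \<integral>\<^sup>+ y. ennreal (cn_density (y - h x)) * indicator A (V x, y) \<partial>lborel \<partial>F)"
    by (subst nn_integral_output) simp_all
  \<comment> \<open>The inner integral depends on \<open>x\<close> only through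
    \<open>(V x, h x)\<close>, which is the form in which \<open>law\<close> applies.\<close>
  also have "\<dots> = (\<integral>\<^sup>+ x. (\<lambda>z. \<integral>\<^sup>+ y. ennreal (cn_density (y - snd z)) * indicator A (fst z, y) \<partial>lborel) (V x, h x) \<partial>F)"
    by simp
  also have "\<dots> = (\<integral>\<^sup>+ v. \<integral>\<^sup>+ r. \<integral>\<^sup>+ y. ennreal (cn_density (y - H (v, r))) * indicator A (v, y)
      \<partial>lborel \<partial>R \<partial>distr F S V)"
    by (subst nn_integral_V_h) simp_all
  also have "\<dots> = (\<integral>\<^sup>+ v. \<integral>\<^sup>+ y. ennreal (k (v, y)) * indicator A (v, y) \<partial>lborel \<partial>distr F S V)"
  proof (rule nn_integral_cong)
    fix v assume "v \<in> space (distr F S V)"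
    then have [measurable]: "v \<in> space S" by simp
    have "(\<integral>\<^sup>+ r. \<integral>\<^sup>+ y. ennreal (cn_density (y - H (v, r))) * indicator A (v, y) \<partial>lborel \<partial>R)
      = (\<integral>\<^sup>+ y. \<integral>\<^sup>+ r. ennreal (cn_density (y - H (v, r))) * indicator A (v, y) \<partial>R \<partial>lborel)"
      by (rule RL.Fubini'[symmetric]) simp
    also have "\<dots> = (\<integral>\<^sup>+ y. ennreal (k (v, y)) * indicator A (v, y) \<partial>lborel)"
      by (simp add: nn_integral_multc ennreal_k)
    finally show "(\<integral>\<^sup>+ r. \<integral>\<^sup>+ y. ennreal (cn_density (y - H (v, r))) * indicator A (v, y) \<partial>lborel \<partial>R)
      = (\<integral>\<^sup>+ y. ennreal (k (v, y)) * indicator A (v, y) \<partial>lborel)" .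
  qed
  also have "\<dots> = (\<integral>\<^sup>+ z. ennreal (k z) * indicator A z \<partial>(distr F S V \<Otimes>\<^sub>M lborel))"
    using A by (subst lborel.nn_integral_fst[symmetric]) simp_all
  also have "\<dots> = emeasure (density (distr F S V \<Otimes>\<^sub>M lborel) (\<lambda>z. ennreal (k z))) A"
    using A by (simp add: emeasure_density)
  finally show "emeasure (distr M (distr F S V \<Otimes>\<^sub>M lborel) (\<lambda>w. (V (fst w), Y w))) A
    = emeasure (density (distr F S V \<Otimes>\<^sub>M lborel) (\<lambda>z. ennreal (k z))) A" .
qed simp_all

lemma channel:
  assumes "1 < b"
  shows "channel M b S (\<lambda>w. V (fst w)) Y k p"
proof -
  interpret I: information_space M b
    using assms by unfold_locales
  show ?thesis
    by unfold_locales (simp_all add: distributed_joint distributed_output k_pos p_pos)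
qed

end

section \<open>Bounds on mutual information under Gaussian noise\<close>

context gaussian_output
begin

lemma distr_noise: "distr M borel (\<lambda>w. \<zeta> (snd w)) = CN"
proof -
  have "distr M borel (\<lambda>w. \<zeta> (snd w)) = distr (distr M N snd) borel \<zeta>"
    by (simp add: distr_distr comp_def)
  then show ?thesis
    by (simp add: distr_pair_snd F.prob_space_axioms N.sigma_finite_measure_axioms noise)
qed

lemma integrable_noise: "integrable M (\<lambda>w. (norm (\<zeta> (snd w)))\<^sup>2)"
  using integrable_CN_norm_sq[where 'n = 'n]
  unfolding distr_noise[symmetric] by (subst (asm) integrable_distr_eq) simp_all

lemma expectation_noise: "(\<integral>w. (norm (\<zeta> (snd w)))\<^sup>2 \<partial>M) = noise_power TYPE('n)"
  unfolding distr_noise[symmetric] by (subst integral_distr) simp_all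

lemma integrable_input:
  fixes g :: "'x \<Rightarrow> real"
  shows "integrable F g \<Longrightarrow> integrable M (\<lambda>w. g (fst w))"
  using integrable_distr_eq[of fst M F g] by (auto simp: N.distr_pair_fst)

lemma expectation_input:
  fixes g :: "'x \<Rightarrow> real"
  assumes "g \<in> borel_measurable F"
  shows "(\<integral>w. g (fst w) \<partial>M) = (\<integral>x. g x \<partial>F)"
  using integral_distr[of fst M F g] assms by (simp add: N.distr_pair_fst)

text \<open>When \<open>V\<close> determines the noiseless output, its conditional law is a point
  mass; any probability space can index this mixture, and \<open>N\<close> is at hand. Equality
  almost everywhere is the right form because the auxiliary variable reproduces an input entry only
  outside a null set.\<close>

lemma gaussian_mixture_deterministic:
  assumes [measurable]: "V \<in> measurable F S" "h' \<in> borel_measurable S"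
    and h: "AE x in F. h x = h' (V x)"
  shows "gaussian_mixture F N \<zeta> h N S V (\<lambda>z. h' (fst z))"
proof unfold_locales
  fix G :: "_ \<times> (complex ^ 'n) \<Rightarrow> ennreal" assume [measurable]: "G \<in> borel_measurable (S \<Otimes>\<^sub>M borel)"
  have "(\<integral>\<^sup>+ x. G (V x, h x) \<partial>F) = (\<integral>\<^sup>+ x. G (V x, h' (V x)) \<partial>F)"
    using h by (intro nn_integral_cong_AE) auto
  then show "(\<integral>\<^sup>+ x. G (V x, h x) \<partial>F) = (\<integral>\<^sup>+ x. \<integral>\<^sup>+ n. G (V x, h' (fst (V x, n))) \<partial>N \<partial>F)"
    by (simp add: N.emeasure_space_1)
qed simp_all

lemma deterministic_channel:
  assumes "1 < b" "V \<in> measurable F S" "h' \<in> borel_measurable S"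
    and "AE x in F. h x = h' (V x)"
  shows "channel M b S (\<lambda>w. V (fst w)) Y (\<lambda>z. cn_density (snd z - h' (fst z))) p"
proof -
  interpret G: gaussian_mixture F N \<zeta> h N S V "\<lambda>z. h' (fst z)"
    by (rule gaussian_mixture_deterministic) fact+
  have "G.k = (\<lambda>z. cn_density (snd z - h' (fst z)))"
    by (auto simp: G.k_def N.prob_space)
  then show ?thesis using G.channel[OF assms(1)] by simp
qed

lemma mutual_information_comp_nonneg:
  assumes b: "1 < b" and V[measurable]: "V \<in> measurable F S" and h': "h' \<in> borel_measurable S"
    and h: "AE x in F. h x = h' (V x)" and \<phi>: "\<phi> \<in> measurable S S'"
  shows "0 \<le> prob_space.mutual_information M b borel S' Y (\<lambda>w. \<phi> (V (fst w)))"
proof -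
  interpret c: channel M b S "\<lambda>w. V (fst w)" Y "\<lambda>z. cn_density (snd z - h' (fst z))" p
    by (rule deterministic_channel) fact+
  show ?thesis
    by (rule c.mutual_information_comp_nonneg[OF _ _ \<phi> c.absolutely_continuous_joint]) simp_all
qed

text \<open>Comparison with a spike density reduces the output to its coordinate \<open>i\<close>.
  In \<open>C\<close>, the term \<open>ln (1 + P)\<close> is the capacity of the scalar channel in
  nats; the constants are the price of estimating the output power by \<open>norm_add_sq_le\<close>
  instead of using that signal and noise are independent.\<close>

lemma mutual_information_scalar_le:
  assumes b: "1 < b" and P: "0 < P"
    and V[measurable]: "V \<in> measurable F S" and g[measurable]: "g \<in> borel_measurable S"
    and h: "\<And>x. x \<in> space F \<Longrightarrow> h x = axis i (g (V x))"
    and power: "(\<integral>\<^sup>+ x. ennreal ((norm (g (V x)))\<^sup>2) \<partial>F) \<le> ennreal P"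
  defines "C \<equiv> ln (1 + P) + 2 + 2 * noise_power TYPE('n)"
  shows "prob_space.mutual_information M b S borel (\<lambda>w. V (fst w)) Y \<le> C / ln b"
    and "prob_space.mutual_information M b borel S Y (\<lambda>w. V (fst w)) \<le> C / ln b"
proof -
  interpret c: channel M b S "\<lambda>w. V (fst w)" Y "\<lambda>z. cn_density (snd z - axis i (g (fst z)))" p
    using h by (intro deterministic_channel b) simp_all
  \<comment> \<open>Output power for signal power \<open>P\<close> and unit noise variance. As
    \<open>s \<ge> 1\<close>, division by \<open>s\<close> does not enlarge the noise term.\<close>
  define s where "s = 1 + P"
  have s: "0 < s" "1 \<le> s" using P by (simp_all add: s_def)
  let ?m = "noise_power TYPE('n)"
  let ?q = "spike_density s i"
  let ?g = "\<lambda>w. (norm (g (V (fst w))))\<^sup>2" and ?z = "\<lambda>w. (norm (\<zeta> (snd w)))\<^sup>2"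
  let ?R = "\<lambda>w. ln (cn_density (Y w - axis i (g (V (fst w)))) / ?q (Y w))"
  have iF: "integrable F (\<lambda>x. (norm (g (V x)))\<^sup>2)"
    using power by (intro integrableI_nonneg) (auto intro: le_less_trans)
  have ig: "integrable M ?g"
    using integrable_input[OF iF] by simp
  have "ennreal (\<integral>x. (norm (g (V x)))\<^sup>2 \<partial>F) \<le> ennreal P"
    using power iF by (subst nn_integral_eq_integral[symmetric]) simp_all
  then have eg: "(\<integral>w. ?g w \<partial>M) \<le> P"
    using P expectation_input[of "\<lambda>x. (norm (g (V x)))\<^sup>2"] by simp
  have m: "0 \<le> ?m" by simp
  have e: "?R w = ln s + (norm (g (V (fst w)) + \<zeta> (snd w) $ i))\<^sup>2 / s - (norm (\<zeta> (snd w) $ i))\<^sup>2"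
    if "w \<in> space M" for w
  proof -
    have "h (fst w) = axis i (g (V (fst w)))" using that by (intro h) (auto simp: space_pair_measure)
    then show ?thesis using ln_cn_density_div_spike_density[OF s(1)] by simp
  qed
  have ub: "(norm (g (V (fst w)) + \<zeta> (snd w) $ i))\<^sup>2 / s \<le> (2 * ?g w + 2 * ?z w) / s" for w
  proof (intro divide_right_mono)
    have "(norm (\<zeta> (snd w) $ i))\<^sup>2 \<le> ?z w"
      by (intro power_mono) (simp_all add: Finite_Cartesian_Product.norm_nth_le)
    then show "(norm (g (V (fst w)) + \<zeta> (snd w) $ i))\<^sup>2 \<le> 2 * ?g w + 2 * ?z w"
      using norm_add_sq_le[of "g (V (fst w))" "\<zeta> (snd w) $ i"] by linarith
  qed (use s in simp)
  have lz: "(norm (\<zeta> (snd w) $ i))\<^sup>2 \<le> ?z w" for w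
    by (intro power_mono) (simp_all add: Finite_Cartesian_Product.norm_nth_le)
  have iR: "integrable M ?R"
  proof (rule Bochner_Integration.integrable_bound)
    show "integrable M (\<lambda>w. \<bar>ln s\<bar> + ((2 * ?g w + 2 * ?z w) / s + ?z w))"
      using ig integrable_noise by simp
    show "AE w in M. norm (?R w) \<le> norm (\<bar>ln s\<bar> + ((2 * ?g w + 2 * ?z w) / s + ?z w))"
    proof (rule AE_I2)
      fix w assume w: "w \<in> space M"
      have "0 \<le> (norm (g (V (fst w)) + \<zeta> (snd w) $ i))\<^sup>2 / s" using s by simp
      moreover have "0 \<le> (norm (\<zeta> (snd w) $ i))\<^sup>2" by simp
      ultimately show "norm (?R w) \<le> norm (\<bar>ln s\<bar> + ((2 * ?g w + 2 * ?z w) / s + ?z w))"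
        unfolding e[OF w] real_norm_def using ub[of w] lz[of w] by linarith
    qed
  qed measurable
  have "(\<integral>w. ?R w \<partial>M) \<le> (\<integral>w. ln s + (2 * ?g w + 2 * ?z w) / s \<partial>M)"
  proof (rule integral_mono[OF iR])
    fix w assume w: "w \<in> space M"
    have "0 \<le> (norm (\<zeta> (snd w) $ i))\<^sup>2" by simp
    then show "?R w \<le> ln s + (2 * ?g w + 2 * ?z w) / s"
      unfolding e[OF w] using ub[of w] by linarith
  qed (use ig integrable_noise in simp)
  also have "\<dots> = ln s + (2 * (\<integral>w. ?g w \<partial>M) + 2 * ?m) / s"
    using ig integrable_noise by (simp add: FN.prob_space expectation_noise)
  also have "\<dots> \<le> ln s + (2 * s + 2 * ?m * s) / s"
  proof -
    have "?m * 1 \<le> ?m * s" using m s by (intro mult_left_mono)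
    then show ?thesis
      using eg s by (intro add_left_mono divide_right_mono) (simp_all add: s_def)
  qed
  also have "\<dots> = C" using s by (simp add: C_def s_def field_simps)
  finally have le: "(\<integral>w. ?R w \<partial>M) \<le> C" .
  show "prob_space.mutual_information M b S borel (\<lambda>w. V (fst w)) Y \<le> C / ln b"
    "prob_space.mutual_information M b borel S Y (\<lambda>w. V (fst w)) \<le> C / ln b"
    using c.mutual_information_le[of ?q C] spike_density_pos[OF s(1), of i] nn_integral_spike_density[OF s(1), of i]
      iR le by simp_all
qed

text \<open>Since \<open>V\<close> fixes \<open>h\<close>, the conditional density at the output is
  almost surely the noise density at the noise. Its mean logarithm is the constant \<open>D\<close>,
  so the input enters only through the ceiling \<open>B\<close>: on the output density in the first
  bound, on the conditional density given \<open>V'\<close> in the second.\<close>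

lemma mutual_information_ge:
  assumes b: "1 < b"
    and V[measurable]: "V \<in> measurable F S" and h'[measurable]: "h' \<in> borel_measurable S"
    and h: "AE x in F. h x = h' (V x)"
    and ih: "integrable F (\<lambda>x. (norm (h x))\<^sup>2)"
  defines "D \<equiv> - noise_power TYPE('n) - real CARD('n) * ln pi"
  shows "(\<And>y. p y \<le> B) \<Longrightarrow>
      (D - ln B) / ln b \<le> prob_space.mutual_information M b S borel (\<lambda>w. V (fst w)) Y"
    and "gaussian_mixture F N \<zeta> h R S' V' H \<Longrightarrow> (\<And>z. gaussian_mixture.k R H z \<le> B) \<Longrightarrow>
      (D - ln B) / ln b \<le> prob_space.mutual_information M b borel S Y (\<lambda>w. V (fst w))
        - prob_space.mutual_information M b borel S' Y (\<lambda>w. V' (fst w))"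
proof -
  interpret c: channel M b S "\<lambda>w. V (fst w)" Y "\<lambda>z. cn_density (snd z - h' (fst z))" p
    using h by (intro deterministic_channel b) simp_all
  have "AE w in M. h (fst w) = h' (V (fst w))"
    using h by (intro AE_distrD[of fst M F]) (simp_all only: N.distr_pair_fst measurable_fst)
  then have e: "AE w in M. cn_density (snd (V (fst w), Y w) - h' (fst (V (fst w), Y w))) = cn_density (\<zeta> (snd w))"
    by eventually_elim simp
  have mean: "(\<integral>w. ln (cn_density (snd (V (fst w), Y w) - h' (fst (V (fst w), Y w)))) \<partial>M) = D"
  proof -
    have "(\<integral>w. ln (cn_density (snd (V (fst w), Y w) - h' (fst (V (fst w), Y w)))) \<partial>M)
      = (\<integral>w. - (norm (\<zeta> (snd w)))\<^sup>2 - real CARD('n) * ln pi \<partial>M)"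
    proof (rule integral_cong_AE)
      show "AE w in M. ln (cn_density (snd (V (fst w), Y w) - h' (fst (V (fst w), Y w))))
        = - (norm (\<zeta> (snd w)))\<^sup>2 - real CARD('n) * ln pi"
        using e by eventually_elim (simp only: ln_cn_density)
    qed measurable
    also have "\<dots> = D"
      using integrable_noise by (simp add: FN.prob_space expectation_noise D_def)
    finally show ?thesis .
  qed
  have ik: "integrable M (\<lambda>w. ln (cn_density (snd (V (fst w), Y w) - h' (fst (V (fst w), Y w)))))"
  proof (rule integrable_cong_AE[THEN iffD2])
    show "integrable M (\<lambda>w. - (norm (\<zeta> (snd w)))\<^sup>2 - real CARD('n) * ln pi)"
      using integrable_noise by simp
    show "AE w in M. ln (cn_density (snd (V (fst w), Y w) - h' (fst (V (fst w), Y w))))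
        = - (norm (\<zeta> (snd w)))\<^sup>2 - real CARD('n) * ln pi"
      using e by eventually_elim (simp only: ln_cn_density)
  qed measurable
  \<comment> \<open>For integrability any comparison density will do. With \<open>cn_density\<close>
    the log ratio is the squared norm of the output minus that of the noise, integrable because the
    noiseless output has finite power.\<close>
  have "integrable M (\<lambda>w. ln (cn_density (snd (V (fst w), Y w) - h' (fst (V (fst w), Y w))) / cn_density (Y w)))"
  proof (rule Bochner_Integration.integrable_bound)
    show "integrable M (\<lambda>w. 2 * (norm (h (fst w)))\<^sup>2 + 3 * (norm (\<zeta> (snd w)))\<^sup>2)"
      using integrable_noise integrable_input[OF ih] by simp
    show "AE w in M. norm (ln (cn_density (snd (V (fst w), Y w) - h' (fst (V (fst w), Y w))) / cn_density (Y w)))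
      \<le> norm (2 * (norm (h (fst w)))\<^sup>2 + 3 * (norm (\<zeta> (snd w)))\<^sup>2)"
      using e
    proof eventually_elim
      fix w assume e: "cn_density (snd (V (fst w), Y w) - h' (fst (V (fst w), Y w))) = cn_density (\<zeta> (snd w))"
      have "ln (cn_density (\<zeta> (snd w)) / cn_density (Y w)) = (norm (Y w))\<^sup>2 - (norm (\<zeta> (snd w)))\<^sup>2"
        using cn_density_pos[of "\<zeta> (snd w)", THEN less_imp_neq] cn_density_pos[of "Y w", THEN less_imp_neq]
        by (simp add: ln_div ln_cn_density del: cn_density_pos)
      moreover have "0 \<le> (norm (Y w))\<^sup>2" "0 \<le> (norm (h (fst w)))\<^sup>2" "0 \<le> (norm (\<zeta> (snd w)))\<^sup>2"
        by simp_all
      ultimately show "norm (ln (cn_density (snd (V (fst w), Y w) - h' (fst (V (fst w), Y w))) / cn_density (Y w)))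
        \<le> norm (2 * (norm (h (fst w)))\<^sup>2 + 3 * (norm (\<zeta> (snd w)))\<^sup>2)"
        unfolding e real_norm_def
        using norm_add_sq_le[of "h (fst w)" "\<zeta> (snd w)"] by linarith
    qed
  qed measurable
  moreover have "(\<integral>\<^sup>+ y. ennreal (cn_density (y :: complex ^ 'n)) \<partial>lborel) \<le> 1"
    using nn_integral_CN[of "\<lambda>_ :: complex ^ 'n. 1"] prob_space.emeasure_space_1[OF prob_space_CN[where 'n = 'n]]
    by simp
  ultimately have int: "integrable M (\<lambda>w. ln (cn_density (snd (V (fst w), Y w) - h' (fst (V (fst w), Y w))) / p (Y w)))"
    by (intro c.expectation_ln_ratio_le(1)[of cn_density]) simp_all
  show "(D - ln B) / ln b \<le> prob_space.mutual_information M b S borel (\<lambda>w. V (fst w)) Y"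
    if "\<And>y. p y \<le> B"
    using c.mutual_information_ge(1)[OF int ik that] unfolding mean .
  show "(D - ln B) / ln b \<le> prob_space.mutual_information M b borel S Y (\<lambda>w. V (fst w))
        - prob_space.mutual_information M b borel S' Y (\<lambda>w. V' (fst w))"
    if G: "gaussian_mixture F N \<zeta> h R S' V' H" and k: "\<And>z. gaussian_mixture.k R H z \<le> B"
  proof -
    interpret G: gaussian_mixture F N \<zeta> h R S' V' H by (rule G)
    show ?thesis
      using c.mutual_information_diff_ge[OF int ik G.p_le G.channel[OF b] k, OF k] unfolding mean .
  qed
qed

end

subsection \<open>A relay channel with three scalar links\<close>

definition unit_matrix :: "'r \<Rightarrow> 't \<Rightarrow> complex ^ 't ^ 'r" where
  "unit_matrix r t = (\<chi> i j. if i = r \<and> j = t then 1 else 0)"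

lemma unit_matrix_mult: "unit_matrix r t *v x = axis r (x $ t)"
  for x :: "complex ^ 't::finite"
  by (auto simp: vec_eq_iff unit_matrix_def matrix_vector_mult_def axis_def if_distrib[of "\<lambda>c. c * _"]
      cong: if_cong)

lemma axis_nth_neq: "i \<noteq> l \<Longrightarrow> axis i x $ l = 0"
  by (simp add: axis_def)

lemma norm_nth_sq_le: "(norm ((x :: complex ^ 'n::finite) $ i))\<^sup>2 \<le> (norm x)\<^sup>2"
  by (intro power_mono Finite_Cartesian_Product.norm_nth_le) simp

lemma gaussian_output_fst:
  assumes "prob_space F" "h \<in> borel_measurable F"
  shows "gaussian_output F ((CN :: (complex ^ 'r2::finite) measure) \<Otimes>\<^sub>M (CN :: (complex ^ 'r3::finite) measure)) fst h"
proof -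
  interpret F: prob_space F by fact
  interpret A: prob_space "CN :: (complex ^ 'r2) measure" by (rule prob_space_CN)
  interpret B: prob_space "CN :: (complex ^ 'r3) measure" by (rule prob_space_CN)
  interpret AB: pair_prob_space "CN :: (complex ^ 'r2) measure" "CN :: (complex ^ 'r3) measure" ..
  have "distr ((CN :: (complex ^ 'r2) measure) \<Otimes>\<^sub>M (CN :: (complex ^ 'r3) measure)) borel fst
    = distr ((CN :: (complex ^ 'r2) measure) \<Otimes>\<^sub>M (CN :: (complex ^ 'r3) measure)) CN fst"
    by (rule distr_cong) simp_all
  then show ?thesis
    using assms(2) by unfold_locales (simp_all add: B.distr_pair_fst)
qed

lemma gaussian_output_snd:
  assumes "prob_space F" "h \<in> borel_measurable F"
  shows "gaussian_output F ((CN :: (complex ^ 'r2::finite) measure) \<Otimes>\<^sub>M (CN :: (complex ^ 'r3::finite) measure)) snd h"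
proof -
  interpret F: prob_space F by fact
  interpret A: prob_space "CN :: (complex ^ 'r2) measure" by (rule prob_space_CN)
  interpret B: prob_space "CN :: (complex ^ 'r3) measure" by (rule prob_space_CN)
  interpret AB: pair_prob_space "CN :: (complex ^ 'r2) measure" "CN :: (complex ^ 'r3) measure" ..
  have "distr ((CN :: (complex ^ 'r2) measure) \<Otimes>\<^sub>M (CN :: (complex ^ 'r3) measure)) borel snd
    = distr ((CN :: (complex ^ 'r2) measure) \<Otimes>\<^sub>M (CN :: (complex ^ 'r3) measure)) CN snd"
    by (rule distr_cong) simp_all
  then show ?thesis
    using assms(2)
    by unfold_locales (simp_all add: distr_pair_snd A.prob_space_axioms B.sigma_finite_measure_axioms)
qed

section \<open>Upper bounds for direct transmission and decode-forward\<close>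

lemma R_DT_le:
  fixes i :: "'t1::finite" and s :: "'r3::finite"
  assumes P: "0 < P"
  shows "R_DT (unit_matrix s i) P \<le> ereal ((ln (1 + P) + 2 + 2 * noise_power TYPE('r3)) / ln 2)"
  unfolding R_DT_def Let_def
proof (rule SUP_least)
  fix F :: "(complex ^ 't1) measure" assume F: "F \<in> dt_inputs P"
  interpret F: prob_space F using F by (simp add: dt_inputs_def)
  have sF[measurable_cong]: "sets F = sets borel" using F by (simp add: dt_inputs_def)
  interpret Z: prob_space "CN :: (complex ^ 'r3) measure" by (rule prob_space_CN)
  have CN: "distr (CN :: (complex ^ 'r3) measure) borel (\<lambda>z. z) = CN"
    by (rule distr_id2) simp
  interpret O: gaussian_output F CN "\<lambda>z. z" "\<lambda>x. unit_matrix s i *v x"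
    by unfold_locales (simp_all add: CN unit_matrix_mult)
  have "(\<integral>\<^sup>+ x. ennreal ((norm (x $ i))\<^sup>2) \<partial>F) \<le> (\<integral>\<^sup>+ x. ennreal ((norm x)\<^sup>2) \<partial>F)"
    by (intro nn_integral_mono ennreal_leI norm_nth_sq_le)
  also have "\<dots> \<le> ennreal P" using F by (simp add: dt_inputs_def)
  finally have "prob_space.mutual_information (F \<Otimes>\<^sub>M CN) 2 borel borel fst (\<lambda>w. unit_matrix s i *v fst w + snd w)
    \<le> (ln (1 + P) + 2 + 2 * noise_power TYPE('r3)) / ln 2"
    using P by (intro O.mutual_information_scalar_le(1)[where g = "\<lambda>x. x $ i" and V = "\<lambda>x. x"])
      (simp_all add: unit_matrix_mult)
  then show "ereal (prob_space.mutual_information (F \<Otimes>\<^sub>M CN) 2 borel borel (\<lambda>(x1, z3). x1)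
      (\<lambda>(x1, z3). unit_matrix s i *v x1 + z3))
    \<le> ereal ((ln (1 + P) + 2 + 2 * noise_power TYPE('r3)) / ln 2)"
    by (simp add: case_prod_unfold)
qed

text \<open>The relay sees a single scalar link, so its term of the minimum limits the rate whatever
  the destination receives. That term is \<open>I(Y2;X1,X2) - I(Y2;X2)\<close>: the first part falls
  under the scalar bound, and the second is nonnegative.\<close>

lemma R_DF_le:
  fixes i :: "'t1::finite" and r :: "'r2::finite" and G31 :: "complex ^ 't1 ^ 'r3::finite"
    and G32 :: "complex ^ 't2::finite ^ 'r3"
  assumes P: "0 < P"
  shows "R_DF (unit_matrix r i) G31 G32 P \<le> ereal ((ln (1 + P) + 2 + 2 * noise_power TYPE('r2)) / ln 2)"
  unfolding R_DF_def Let_def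
proof (rule SUP_least)
  fix F :: "((complex ^ 't1) \<times> (complex ^ 't2)) measure" assume F: "F \<in> df_inputs P"
  interpret F: prob_space F using F by (simp add: df_inputs_def)
  have sF[measurable_cong]: "sets F = sets (borel \<Otimes>\<^sub>M borel)" using F by (simp add: df_inputs_def)
  let ?N = "(CN :: (complex ^ 'r2) measure) \<Otimes>\<^sub>M (CN :: (complex ^ 'r3) measure)"
  interpret O: gaussian_output F ?N fst "\<lambda>x. axis r (fst x $ i)"
    by (rule gaussian_output_fst) (unfold_locales, measurable)
  let ?Y = "\<lambda>w. axis r (fst (fst w) $ i) + fst (snd w)"
  have "(\<integral>\<^sup>+ x. ennreal ((norm (fst x $ i))\<^sup>2) \<partial>F) \<le> (\<integral>\<^sup>+ x. ennreal ((norm (fst x))\<^sup>2) \<partial>F)"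
    by (intro nn_integral_mono ennreal_leI norm_nth_sq_le)
  also have "\<dots> \<le> ennreal P" using F by (simp add: df_inputs_def case_prod_unfold)
  finally have 1: "prob_space.mutual_information (F \<Otimes>\<^sub>M ?N) 2 borel (borel \<Otimes>\<^sub>M borel) ?Y (\<lambda>w. (fst (fst w), snd (fst w)))
    \<le> (ln (1 + P) + 2 + 2 * noise_power TYPE('r2)) / ln 2"
    using P by (intro O.mutual_information_scalar_le(2)[where g = "\<lambda>x. fst x $ i" and V = "\<lambda>x. (fst x, snd x)"])
      simp_all
  have 2: "0 \<le> prob_space.mutual_information (F \<Otimes>\<^sub>M ?N) 2 borel borel ?Y (\<lambda>w. snd (fst w))"
    by (rule O.mutual_information_comp_nonneg[where V = "\<lambda>x. x" and h' = "\<lambda>x. axis r (fst x $ i)"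
          and S = "borel \<Otimes>\<^sub>M borel" and \<phi> = snd]) simp_all
  let ?A = "prob_space.conditional_mutual_information (F \<Otimes>\<^sub>M ?N) 2 borel borel borel
      (\<lambda>((x1, x2), z2, z3). unit_matrix r i *v x1 + z2) (\<lambda>((x1, x2), z2, z3). x1) (\<lambda>((x1, x2), z2, z3). x2)"
  have "?A \<le> (ln (1 + P) + 2 + 2 * noise_power TYPE('r2)) / ln 2"
    using 1 2 by (simp add: O.FN.conditional_mutual_information_def case_prod_unfold unit_matrix_mult)
  then show "ereal (min
      (prob_space.mutual_information (F \<Otimes>\<^sub>M ?N) 2 (borel \<Otimes>\<^sub>M borel) borel
        (\<lambda>w. ((\<lambda>((x1, x2), z2, z3). x1) w, (\<lambda>((x1, x2), z2, z3). x2) w))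
        (\<lambda>((x1, x2), z2, z3). G31 *v x1 + G32 *v x2 + z3)) ?A)
    \<le> ereal ((ln (1 + P) + 2 + 2 * noise_power TYPE('r2)) / ln 2)"
    unfolding ereal_less_eq(3) by (rule min.coboundedI2)
qed

section \<open>Inputs uniform on a disc\<close>

definition disc :: "real \<Rightarrow> complex measure" where
  "disc R = uniform_measure lborel (cball 0 R)"

lemma sets_disc [simp, measurable_cong]: "sets (disc R) = sets borel"
  by (simp add: disc_def)

lemma emeasure_complex_cball: "0 < R \<Longrightarrow> emeasure lborel (cball (0 :: complex) R) = ennreal (pi * R\<^sup>2)"
  by (subst emeasure_cball) (simp_all add: unit_ball_vol_2)

lemma prob_space_disc: "0 < R \<Longrightarrow> prob_space (disc R)"
  unfolding disc_def
  by (intro prob_space_uniform_measure) (simp_all add: emeasure_complex_cball not_le)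

lemma nn_integral_disc_le:
  assumes R: "0 < R" and [measurable]: "f \<in> borel_measurable borel"
  shows "(\<integral>\<^sup>+ a. f a \<partial>disc R) \<le> ennreal (1 / (pi * R\<^sup>2)) * (\<integral>\<^sup>+ a. f a \<partial>lborel)"
proof -
  have "(\<integral>\<^sup>+ a. f a \<partial>disc R) = (\<integral>\<^sup>+ a. f a * indicator (cball 0 R) a \<partial>lborel) / ennreal (pi * R\<^sup>2)"
    unfolding disc_def using R by (subst nn_integral_uniform_measure) (simp_all add: emeasure_complex_cball)
  also have "\<dots> \<le> (\<integral>\<^sup>+ a. f a \<partial>lborel) / ennreal (pi * R\<^sup>2)"
    by (intro divide_right_mono_ennreal nn_integral_mono) (auto split: split_indicator)
  also have "\<dots> = ennreal (1 / (pi * R\<^sup>2)) * (\<integral>\<^sup>+ a. f a \<partial>lborel)"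
    using R by (simp add: divide_ennreal_def inverse_ennreal mult.commute inverse_eq_divide)
  finally show ?thesis .
qed

text \<open>The Gaussian integral over the plane and the area of the unit disc are both
  \<open>pi\<close> and cancel. This is the source of every factor \<open>1 / R\<^sup>2\<close> in
  the output densities.\<close>

lemma nn_integral_disc_exp_le:
  assumes R: "0 < R"
  shows "(\<integral>\<^sup>+ a. ennreal (exp (- (norm (w - a))\<^sup>2)) \<partial>disc R) \<le> ennreal (1 / R\<^sup>2)"
proof -
  have "(\<integral>\<^sup>+ a. ennreal (exp (- (norm (w - a))\<^sup>2)) \<partial>disc R) \<le> ennreal (1 / (pi * R\<^sup>2)) * ennreal pi"
    using nn_integral_disc_le[OF R, of "\<lambda>a. ennreal (exp (- (norm (w - a))\<^sup>2))"]
    by (simp add: nn_integral_exp_complex)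
  also have "\<dots> = ennreal (1 / R\<^sup>2)"
    using R by (simp add: ennreal_mult[symmetric])
  finally show ?thesis .
qed

lemma nn_integral_disc_power:
  assumes R: "0 < R"
  shows "(\<integral>\<^sup>+ a. ennreal ((norm a)\<^sup>2) \<partial>disc R) \<le> ennreal (R\<^sup>2)"
proof -
  interpret prob_space "disc R" by (rule prob_space_disc) fact
  have "AE a in disc R. a \<in> cball 0 R"
    unfolding disc_def by (intro AE_uniform_measureI) simp_all
  then have "(\<integral>\<^sup>+ a. ennreal ((norm a)\<^sup>2) \<partial>disc R) \<le> (\<integral>\<^sup>+ a. ennreal (R\<^sup>2) \<partial>disc R)"
    by (intro nn_integral_mono_AE) (auto elim!: eventually_mono intro!: ennreal_leI power_mono)
  also have "\<dots> = ennreal (R\<^sup>2)" by (simp add: emeasure_space_1)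
  finally show ?thesis .
qed

lemma cn_density_le_coordinate:
  "cn_density (y :: complex ^ 'n::finite) \<le> exp (- (norm (y $ i))\<^sup>2) / pi ^ CARD('n)"
  unfolding cn_density_def using norm_nth_sq_le[of y i] by (intro divide_right_mono) simp_all

lemma cn_density_le_two_coordinates:
  assumes "i \<noteq> j"
  shows "cn_density (y :: complex ^ 'n::finite)
    \<le> exp (- (norm (y $ i))\<^sup>2) * exp (- (norm (y $ j))\<^sup>2) / pi ^ CARD('n)"
proof -
  have "(\<Sum>l\<in>{i, j}. (norm (y $ l))\<^sup>2) \<le> (norm y)\<^sup>2"
    unfolding norm_vec_sq by (intro sum_mono2) simp_all
  then show ?thesis
    using assms unfolding cn_density_def exp_add[symmetric] by (intro divide_right_mono) simp_all
qed

text \<open>Only coordinate \<open>i\<close> is smeared over the disc; the Gaussian factors of the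
  others are bounded by their peaks. The power of \<open>pi\<close> is kept because it cancels the
  \<open>ln pi\<close> term in the mean log density of the noise.\<close>

lemma disc_kernel_le:
  fixes y :: "complex ^ 'n::finite"
  assumes R: "0 < R"
  shows "(\<integral>a. cn_density (y - axis i a) \<partial>disc R) \<le> 1 / (R\<^sup>2 * pi ^ CARD('n))"
proof -
  interpret prob_space "disc R" by (rule prob_space_disc) fact
  have "ennreal (\<integral>a. cn_density (y - axis i a) \<partial>disc R) = (\<integral>\<^sup>+ a. ennreal (cn_density (y - axis i a)) \<partial>disc R)"
    by (intro nn_integral_eq_integral[symmetric] integrable_const_bound[where B = 1])
       (auto simp: cn_density_le_1)
  also have "\<dots> \<le> (\<integral>\<^sup>+ a. ennreal (1 / pi ^ CARD('n)) * ennreal (exp (- (norm (y $ i - a))\<^sup>2)) \<partial>disc R)"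
    using cn_density_le_coordinate[of "y - axis i _" i]
    by (intro nn_integral_mono) (simp add: ennreal_mult[symmetric] ennreal_leI)
  also have "\<dots> = ennreal (1 / pi ^ CARD('n)) * (\<integral>\<^sup>+ a. ennreal (exp (- (norm (y $ i - a))\<^sup>2)) \<partial>disc R)"
    by (rule nn_integral_cmult) simp
  also have "\<dots> \<le> ennreal (1 / pi ^ CARD('n)) * ennreal (1 / R\<^sup>2)"
    by (intro mult_left_mono nn_integral_disc_exp_le R) simp
  also have "\<dots> = ennreal (1 / (R\<^sup>2 * pi ^ CARD('n)))"
    by (simp add: ennreal_mult[symmetric] mult.commute)
  finally show ?thesis by (simp add: ennreal_le_iff)
qed

text \<open>
  The triple \<open>((c, a), b)\<close> consists of the relay input \<open>c\<close>, the sender's symbol \<open>a\<close> for the relay,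
  which serves as auxiliary variable, and the sender's symbol \<open>b\<close> for the destination.
\<close>

definition disc_input :: "real \<Rightarrow> 't1 \<Rightarrow> 't1 \<Rightarrow> 't2 \<Rightarrow>
    ((nat \<Rightarrow> complex) \<times> (complex ^ 't1::finite) \<times> (complex ^ 't2::finite)) measure" where
  "disc_input R i1 i2 j = distr ((disc R \<Otimes>\<^sub>M disc R) \<Otimes>\<^sub>M disc R) (aux_space (Suc 0) \<Otimes>\<^sub>M borel \<Otimes>\<^sub>M borel)
    (\<lambda>((c, a), b). (\<lambda>l\<in>{..<Suc 0}. a, axis i1 a + axis i2 b, axis j c))"

lemma restrict_measurable_aux_space [measurable (raw)]:
  assumes [measurable]: "f \<in> borel_measurable M"
  shows "(\<lambda>x. \<lambda>l\<in>{..<k}. f x) \<in> measurable M (aux_space k)"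
  unfolding aux_space_def by (rule measurable_restrict) simp

lemma aux_space_nth_measurable:
  assumes "f \<in> measurable M (aux_space (Suc 0))"
  shows "(\<lambda>x. f x 0) \<in> borel_measurable M"
  using assms unfolding aux_space_def
  by (rule measurable_compose) (rule measurable_component_singleton, simp)

section \<open>Lower bound for partial decode-forward\<close>

context
  fixes R :: real and i1 i2 :: "'t1::finite" and j :: "'t2::finite"
  assumes R: "0 < R" and i12: "i1 \<noteq> i2"
begin

private abbreviation "F \<equiv> disc_input R i1 i2 j"

interpretation disc: prob_space "disc R" by (rule prob_space_disc) (rule R)

interpretation disc2: pair_prob_space "disc R" "disc R" ..

interpretation disc3: pair_prob_space "disc R \<Otimes>\<^sub>M disc R" "disc R" ..

lemma sets_disc_input [measurable_cong]: "sets F = sets (aux_space (Suc 0) \<Otimes>\<^sub>M borel \<Otimes>\<^sub>M borel)"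
  by (simp add: disc_input_def)

lemma prob_space_disc_input: "prob_space F"
  unfolding disc_input_def by (rule disc3.prob_space_distr) (simp add: case_prod_unfold)

lemma nn_integral_disc_input:
  assumes [measurable]: "f \<in> borel_measurable (aux_space (Suc 0) \<Otimes>\<^sub>M borel \<Otimes>\<^sub>M borel)"
  shows "(\<integral>\<^sup>+ x. f x \<partial>F) = (\<integral>\<^sup>+ c. \<integral>\<^sup>+ a. \<integral>\<^sup>+ b.
    f (\<lambda>l\<in>{..<Suc 0}. a, axis i1 a + axis i2 b, axis j c) \<partial>disc R \<partial>disc R \<partial>disc R)"
proof -
  have "(\<integral>\<^sup>+ x. f x \<partial>F) = (\<integral>\<^sup>+ z. f (\<lambda>l\<in>{..<Suc 0}. snd (fst z), axis i1 (snd (fst z)) + axis i2 (snd z), axis j (fst (fst z)))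
      \<partial>((disc R \<Otimes>\<^sub>M disc R) \<Otimes>\<^sub>M disc R))"
    unfolding disc_input_def case_prod_unfold by (rule nn_integral_distr) measurable
  also have "\<dots> = (\<integral>\<^sup>+ z. \<integral>\<^sup>+ b. f (\<lambda>l\<in>{..<Suc 0}. snd z, axis i1 (snd z) + axis i2 b, axis j (fst z))
      \<partial>disc R \<partial>(disc R \<Otimes>\<^sub>M disc R))"
    by (subst disc.nn_integral_fst[symmetric]) simp_all
  also have "\<dots> = (\<integral>\<^sup>+ c. \<integral>\<^sup>+ a. \<integral>\<^sup>+ b.
    f (\<lambda>l\<in>{..<Suc 0}. a, axis i1 a + axis i2 b, axis j c) \<partial>disc R \<partial>disc R \<partial>disc R)"
    by (subst disc.nn_integral_fst[symmetric]) simp_all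
  finally show ?thesis .
qed

text \<open>The constant 4 comes from \<open>norm_add_sq_le\<close> for the two symbols that share
  \<open>X1\<close>, each of power at most \<open>R\<^sup>2\<close>. It fixes the relation between
  the radius and the power constraint.\<close>

lemma disc_input_power:
  "(\<integral>\<^sup>+ (u, x1, x2). ennreal ((norm x1)\<^sup>2) \<partial>F) \<le> ennreal (4 * R\<^sup>2)"
  "(\<integral>\<^sup>+ (u, x1, x2). ennreal ((norm x2)\<^sup>2) \<partial>F) \<le> ennreal (4 * R\<^sup>2)"
proof -
  have "(\<integral>\<^sup>+ (u, x1, x2). ennreal ((norm x1)\<^sup>2) \<partial>F)
    = (\<integral>\<^sup>+ a. \<integral>\<^sup>+ b. ennreal ((norm (axis i1 a + axis i2 b))\<^sup>2) \<partial>disc R \<partial>disc R)"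
    by (subst nn_integral_disc_input) (simp_all add: disc.emeasure_space_1)
  also have "\<dots> \<le> (\<integral>\<^sup>+ a. \<integral>\<^sup>+ b. 2 * ennreal ((norm a)\<^sup>2) + 2 * ennreal ((norm b)\<^sup>2) \<partial>disc R \<partial>disc R)"
  proof (intro nn_integral_mono)
    fix a b :: complex
    have "(norm (axis i1 a + axis i2 b))\<^sup>2 \<le> 2 * (norm a)\<^sup>2 + 2 * (norm b)\<^sup>2"
      using norm_add_sq_le[of "axis i1 a" "axis i2 b"] by (simp add: norm_axis_complex)
    then have "ennreal ((norm (axis i1 a + axis i2 b))\<^sup>2) \<le> ennreal (2 * (norm a)\<^sup>2 + 2 * (norm b)\<^sup>2)"
      by (rule ennreal_leI)
    then show "ennreal ((norm (axis i1 a + axis i2 b))\<^sup>2) \<le> 2 * ennreal ((norm a)\<^sup>2) + 2 * ennreal ((norm b)\<^sup>2)"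
      by (simp add: ennreal_mult')
  qed
  also have "\<dots> = 2 * (\<integral>\<^sup>+ a. ennreal ((norm a)\<^sup>2) \<partial>disc R) + 2 * (\<integral>\<^sup>+ b. ennreal ((norm b)\<^sup>2) \<partial>disc R)"
  proof -
    have "(\<integral>\<^sup>+ b. 2 * ennreal ((norm a)\<^sup>2) + 2 * ennreal ((norm b)\<^sup>2) \<partial>disc R)
      = 2 * ennreal ((norm a)\<^sup>2) + 2 * (\<integral>\<^sup>+ b. ennreal ((norm b)\<^sup>2) \<partial>disc R)" for a :: complex
      by (subst nn_integral_add) (simp_all add: nn_integral_cmult disc.emeasure_space_1)
    moreover have "(\<integral>\<^sup>+ a. 2 * ennreal ((norm a)\<^sup>2) + I \<partial>disc R)
      = 2 * (\<integral>\<^sup>+ a. ennreal ((norm a)\<^sup>2) \<partial>disc R) + I" for I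
      by (subst nn_integral_add) (simp_all add: nn_integral_cmult disc.emeasure_space_1)
    ultimately show ?thesis by simp
  qed
  also have "\<dots> \<le> 2 * ennreal (R\<^sup>2) + 2 * ennreal (R\<^sup>2)"
    by (intro add_mono mult_left_mono nn_integral_disc_power R) simp_all
  also have "\<dots> = ennreal (4 * R\<^sup>2)"
    by (simp add: ennreal_mult' mult_2[symmetric] mult.assoc[symmetric] distrib_right[symmetric])
  finally show "(\<integral>\<^sup>+ (u, x1, x2). ennreal ((norm x1)\<^sup>2) \<partial>F) \<le> ennreal (4 * R\<^sup>2)" .
  have "(\<integral>\<^sup>+ (u, x1, x2). ennreal ((norm x2)\<^sup>2) \<partial>F) = (\<integral>\<^sup>+ c. ennreal ((norm c)\<^sup>2) \<partial>disc R)"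
    by (subst nn_integral_disc_input) (simp_all add: norm_axis_complex disc.emeasure_space_1)
  also have "\<dots> \<le> ennreal (R\<^sup>2)" by (rule nn_integral_disc_power) (rule R)
  also have "\<dots> \<le> ennreal (4 * R\<^sup>2)" by (intro ennreal_leI) simp
  finally show "(\<integral>\<^sup>+ (u, x1, x2). ennreal ((norm x2)\<^sup>2) \<partial>F) \<le> ennreal (4 * R\<^sup>2)" .
qed

lemma disc_input_in_pdf_inputs: "F \<in> pdf_inputs (Suc 0) (4 * R\<^sup>2)"
  using disc_input_power prob_space_disc_input sets_disc_input by (simp add: pdf_inputs_def)

lemma integrable_disc_input:
  "integrable F (\<lambda>x. (norm (fst (snd x)))\<^sup>2)" "integrable F (\<lambda>x. (norm (snd (snd x)))\<^sup>2)"
  using disc_input_power by (auto intro!: integrableI_nonneg simp: case_prod_unfold intro: le_less_trans)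

lemma integrable_disc_input_axis:
  fixes r :: "'r::finite"
  shows "integrable F (\<lambda>x. (norm (axis r (fst (snd x) $ i)))\<^sup>2)"
  by (rule Bochner_Integration.integrable_bound[OF integrable_disc_input(1)])
     (auto simp: norm_axis_complex Finite_Cartesian_Product.norm_nth_le)

lemma integrable_disc_input_axis2:
  fixes s1 s2 :: "'r::finite"
  shows "integrable F (\<lambda>x. (norm (axis s1 (snd (snd x) $ l) + axis s2 (fst (snd x) $ i)))\<^sup>2)"
proof (rule Bochner_Integration.integrable_bound)
  show "integrable F (\<lambda>x. 2 * (norm (snd (snd x)))\<^sup>2 + 2 * (norm (fst (snd x)))\<^sup>2)"
    using integrable_disc_input by simp
  show "AE x in F. norm ((norm (axis s1 (snd (snd x) $ l) + axis s2 (fst (snd x) $ i)))\<^sup>2)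
    \<le> norm (2 * (norm (snd (snd x)))\<^sup>2 + 2 * (norm (fst (snd x)))\<^sup>2)"
  proof (rule AE_I2)
    fix x :: "(nat \<Rightarrow> complex) \<times> (complex ^ 't1) \<times> (complex ^ 't2)"
    have "(norm (axis s1 (snd (snd x) $ l) + axis s2 (fst (snd x) $ i)))\<^sup>2
      \<le> 2 * (norm (snd (snd x)))\<^sup>2 + 2 * (norm (fst (snd x)))\<^sup>2"
      using norm_add_sq_le[of "axis s1 (snd (snd x) $ l)" "axis s2 (fst (snd x) $ i)"]
        norm_nth_sq_le[of "snd (snd x)" l] norm_nth_sq_le[of "fst (snd x)" i]
      unfolding norm_axis_complex by linarith
    then show "norm ((norm (axis s1 (snd (snd x) $ l) + axis s2 (fst (snd x) $ i)))\<^sup>2)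
      \<le> norm (2 * (norm (snd (snd x)))\<^sup>2 + 2 * (norm (fst (snd x)))\<^sup>2)"
      by simp
  qed
qed measurable

text \<open>Both destination antennas are smeared: \<open>c\<close> reaches \<open>s1\<close> and
  \<open>b\<close> reaches \<open>s2\<close>. As \<open>b\<close> and \<open>c\<close> are
  independent, the two factors \<open>1 / R\<^sup>2\<close> multiply, which gives
  \<open>I(X1,X2;Y3)\<close> the size of two scalar links.\<close>

lemma nn_integral_disc_input_cn_density_le:
  fixes y :: "complex ^ 'n::finite"
  assumes s: "s1 \<noteq> s2"
  shows "(\<integral>x. cn_density (y - (axis s1 (snd (snd x) $ j) + axis s2 (fst (snd x) $ i2))) \<partial>F)
    \<le> 1 / (R ^ 4 * pi ^ CARD('n))"
proof -
  interpret F: prob_space F by (rule prob_space_disc_input)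
  let ?e = "\<lambda>w a. ennreal (exp (- (norm (w - a :: complex))\<^sup>2))"
  have "ennreal (\<integral>x. cn_density (y - (axis s1 (snd (snd x) $ j) + axis s2 (fst (snd x) $ i2))) \<partial>F)
    = (\<integral>\<^sup>+ x. ennreal (cn_density (y - (axis s1 (snd (snd x) $ j) + axis s2 (fst (snd x) $ i2)))) \<partial>F)"
    by (intro nn_integral_eq_integral[symmetric] F.integrable_const_bound[where B = 1])
       (auto simp: cn_density_le_1)
  also have "\<dots> = (\<integral>\<^sup>+ c. \<integral>\<^sup>+ a. \<integral>\<^sup>+ b. ennreal (cn_density (y - (axis s1 c + axis s2 b)))
      \<partial>disc R \<partial>disc R \<partial>disc R)"
    using i12 by (subst nn_integral_disc_input) (simp_all add: axis_nth_neq)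
  also have "\<dots> \<le> (\<integral>\<^sup>+ c. \<integral>\<^sup>+ a. \<integral>\<^sup>+ b. ennreal (1 / pi ^ CARD('n)) * (?e (y $ s1) c * ?e (y $ s2) b)
      \<partial>disc R \<partial>disc R \<partial>disc R)"
  proof (intro nn_integral_mono)
    fix b c :: complex
    show "ennreal (cn_density (y - (axis s1 c + axis s2 b)))
      \<le> ennreal (1 / pi ^ CARD('n)) * (?e (y $ s1) c * ?e (y $ s2) b)"
      using cn_density_le_two_coordinates[OF s, of "y - (axis s1 c + axis s2 b)"] s
      by (simp add: ennreal_mult[symmetric] ennreal_leI axis_nth_neq)
  qed
  also have "\<dots> = ennreal (1 / pi ^ CARD('n)) * ((\<integral>\<^sup>+ c. ?e (y $ s1) c \<partial>disc R) * (\<integral>\<^sup>+ b. ?e (y $ s2) b \<partial>disc R))"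
  proof -
    have "(\<integral>\<^sup>+ b. ennreal (1 / pi ^ CARD('n)) * (?e (y $ s1) c * ?e (y $ s2) b) \<partial>disc R)
      = ennreal (1 / pi ^ CARD('n)) * (?e (y $ s1) c * (\<integral>\<^sup>+ b. ?e (y $ s2) b \<partial>disc R))" for c
      by (subst nn_integral_cmult) (simp_all add: nn_integral_cmult)
    moreover have "(\<integral>\<^sup>+ c. ennreal (1 / pi ^ CARD('n)) * (?e (y $ s1) c * I) \<partial>disc R)
      = ennreal (1 / pi ^ CARD('n)) * ((\<integral>\<^sup>+ c. ?e (y $ s1) c \<partial>disc R) * I)" for I
      by (subst nn_integral_cmult) (simp_all add: nn_integral_multc)
    ultimately show ?thesis by (simp add: disc.emeasure_space_1)
  qed
  also have "\<dots> \<le> ennreal (1 / pi ^ CARD('n)) * (ennreal (1 / R\<^sup>2) * ennreal (1 / R\<^sup>2))"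
    by (intro mult_left_mono mult_mono nn_integral_disc_exp_le R) simp_all
  also have "\<dots> = ennreal (1 / (R ^ 4 * pi ^ CARD('n)))"
    using R by (simp add: ennreal_mult[symmetric] mult.commute power2_eq_square power4_eq_xxxx mult.assoc)
  finally show ?thesis using R by (simp add: ennreal_le_iff)
qed

text \<open>The law of the input lives on a product space with a separate component for
  \<open>U\<close>, where this identity holds only on the support. It lets \<open>U\<close> alone
  determine the noiseless relay output.\<close>

lemma AE_disc_input: "AE x in F. fst (snd x) $ i1 = fst x 0"
proof -
  let ?T = "aux_space (Suc 0) \<Otimes>\<^sub>M (borel :: (complex ^ 't1) measure) \<Otimes>\<^sub>M (borel :: (complex ^ 't2) measure)"
  have [measurable]: "(\<lambda>x. fst x 0) \<in> borel_measurable ?T"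
    by (intro aux_space_nth_measurable measurable_fst)
  have "{x \<in> space ?T. fst (snd x) $ i1 = fst x 0} \<in> sets ?T"
    by (rule measurable_equality_set) measurable
  then show ?thesis
    unfolding disc_input_def case_prod_unfold using i12
    by (subst AE_distr_iff) (simp_all add: axis_nth_neq)
qed

text \<open>The count of \<open>ln R\<close> is 4 for the two smeared destination antennas in the
  first term of the minimum. In the second it is 2 for \<open>a\<close> at the relay plus 2 for
  \<open>b\<close> at the destination once \<open>X2\<close> and \<open>U\<close> are known. The
  \<open>ln pi\<close> terms cancel, so that only noise powers are lost.\<close>

lemma R_PDF_ge:
  fixes r :: "'r2::finite" and s1 s2 :: "'r3::finite"
  assumes s: "s1 \<noteq> s2"
  shows "ereal ((4 * ln R - noise_power TYPE('r2) - noise_power TYPE('r3)) / ln 2)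
    \<le> R_PDF (unit_matrix r i1) (unit_matrix s2 i2) (unit_matrix s1 j) (4 * R\<^sup>2)"
proof -
  let ?m2 = "noise_power TYPE('r2)" and ?m3 = "noise_power TYPE('r3)"
  let ?N = "(CN :: (complex ^ 'r2) measure) \<Otimes>\<^sub>M (CN :: (complex ^ 'r3) measure)"
  let ?A = "aux_space (Suc 0)"
  let ?h2 = "\<lambda>x :: (nat \<Rightarrow> complex) \<times> (complex ^ 't1) \<times> (complex ^ 't2). axis r (fst (snd x) $ i1) :: complex ^ 'r2"
  let ?h3 = "\<lambda>x :: (nat \<Rightarrow> complex) \<times> (complex ^ 't1) \<times> (complex ^ 't2).
    axis s1 (snd (snd x) $ j) + axis s2 (fst (snd x) $ i2) :: complex ^ 'r3"
  interpret F: prob_space F by (rule prob_space_disc_input)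
  interpret O2: gaussian_output F ?N fst ?h2
    by (rule gaussian_output_fst[OF F.prob_space_axioms]) measurable
  interpret O3: gaussian_output F ?N snd ?h3
    by (rule gaussian_output_snd[OF F.prob_space_axioms]) measurable
  let ?I = "prob_space.mutual_information (F \<Otimes>\<^sub>M ?N) 2"
  let ?Y2 = "\<lambda>w. ?h2 (fst w) + fst (snd w)" and ?Y3 = "\<lambda>w. ?h3 (fst w) + snd (snd w)"
  let ?X1 = "\<lambda>w :: _ \<times> (complex ^ 'r2) \<times> (complex ^ 'r3). fst (snd (fst w))"
  let ?X2 = "\<lambda>w :: _ \<times> (complex ^ 'r2) \<times> (complex ^ 'r3). snd (snd (fst w))"
  let ?U = "\<lambda>w :: _ \<times> (complex ^ 'r2) \<times> (complex ^ 'r3). fst (fst w)"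
  have lnB: "ln (1 / (R\<^sup>2 * pi ^ n)) = - 2 * ln R - real n * ln pi"
    "ln (1 / (R ^ 4 * pi ^ n)) = - 4 * ln R - real n * ln pi" for n
    using R by (simp_all add: ln_div ln_mult ln_realpow)
  have 1: "(- ?m3 - real CARD('r3) * ln pi - ln (1 / (R ^ 4 * pi ^ CARD('r3)))) / ln 2
    \<le> ?I (borel \<Otimes>\<^sub>M borel) borel (\<lambda>w. (?X1 w, ?X2 w)) ?Y3"
    by (rule O3.mutual_information_ge(1)[where V = "\<lambda>x. (fst (snd x), snd (snd x))"
          and h' = "\<lambda>v. axis s1 (snd v $ j) + axis s2 (fst v $ i2)"])
       (simp_all add: integrable_disc_input_axis2 O3.p_def nn_integral_disc_input_cn_density_le s)
  \<comment> \<open>Given \<open>(U, X2)\<close>, only noise is left in the relay output. Given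
    \<open>X2\<close> alone, \<open>a\<close> is still uniform on the disc, being independent of
    \<open>c\<close>; this is the mixture described by \<open>V'\<close> and
    \<open>H\<close>.\<close>
  have 2: "(- ?m2 - real CARD('r2) * ln pi - ln (1 / (R\<^sup>2 * pi ^ CARD('r2)))) / ln 2
    \<le> ?I borel (?A \<Otimes>\<^sub>M borel) ?Y2 (\<lambda>w. (?U w, ?X2 w)) - ?I borel borel ?Y2 ?X2"
  proof (rule O2.mutual_information_ge(2)[where V = "\<lambda>x. (fst x, snd (snd x))"
          and h' = "\<lambda>v. axis r (fst v 0)" and V' = "\<lambda>x. snd (snd x)" and R = "disc R"
          and H = "\<lambda>z. axis r (snd z)"])
    show G: "gaussian_mixture F ?N fst ?h2 (disc R) borel (\<lambda>x. snd (snd x)) (\<lambda>z. axis r (snd z))"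
    proof unfold_locales
      fix G :: "(complex ^ 't2) \<times> (complex ^ 'r2) \<Rightarrow> ennreal"
      assume [measurable]: "G \<in> borel_measurable (borel \<Otimes>\<^sub>M borel)"
      show "(\<integral>\<^sup>+ x. G (snd (snd x), ?h2 x) \<partial>F)
        = (\<integral>\<^sup>+ x. \<integral>\<^sup>+ a. G (snd (snd x), axis r (snd (snd (snd x), a))) \<partial>disc R \<partial>F)"
        using i12 by (subst (1 2) nn_integral_disc_input) (simp_all add: axis_nth_neq disc.emeasure_space_1)
    qed simp_all
    show "gaussian_mixture.k (disc R) (\<lambda>z. axis r (snd z)) z \<le> 1 / (R\<^sup>2 * pi ^ CARD('r2))" for z :: "(complex ^ 't2) \<times> _"
      unfolding gaussian_mixture.k_def[OF G] using disc_kernel_le[OF R] by simp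
    show "(\<lambda>v. axis r (fst v 0)) \<in> borel_measurable (?A \<Otimes>\<^sub>M (borel :: (complex ^ 't2) measure))"
      by (intro axis_measurable aux_space_nth_measurable measurable_fst)
    show "AE x in F. ?h2 x = axis r (fst (fst x, snd (snd x)) 0)"
      using AE_disc_input by eventually_elim simp
  qed (simp_all add: integrable_disc_input_axis)
  \<comment> \<open>Here \<open>V\<close> is the full input. Given \<open>(X2, U)\<close>, the
    symbol \<open>c\<close> merely shifts antenna \<open>s1\<close>, while \<open>b\<close> stays
    uniform on the disc and smears antenna \<open>s2\<close>.\<close>
  have 3: "(- ?m3 - real CARD('r3) * ln pi - ln (1 / (R\<^sup>2 * pi ^ CARD('r3)))) / ln 2
    \<le> ?I borel (borel \<Otimes>\<^sub>M borel \<Otimes>\<^sub>M ?A) ?Y3 (\<lambda>w. (?X1 w, ?X2 w, ?U w)) - ?I borel (borel \<Otimes>\<^sub>M ?A) ?Y3 (\<lambda>w. (?X2 w, ?U w))"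
  proof (rule O3.mutual_information_ge(2)[where V = "\<lambda>x. (fst (snd x), snd (snd x), fst x)"
          and h' = "\<lambda>v. axis s1 (fst (snd v) $ j) + axis s2 (fst v $ i2)"
          and V' = "\<lambda>x. (snd (snd x), fst x)" and R = "disc R"
          and H = "\<lambda>z. axis s1 (fst (fst z) $ j) + axis s2 (snd z)"])
    show G: "gaussian_mixture F ?N snd ?h3 (disc R) (borel \<Otimes>\<^sub>M ?A) (\<lambda>x. (snd (snd x), fst x))
      (\<lambda>z. axis s1 (fst (fst z) $ j) + axis s2 (snd z))"
    proof unfold_locales
      fix G :: "((complex ^ 't2) \<times> (nat \<Rightarrow> complex)) \<times> (complex ^ 'r3) \<Rightarrow> ennreal"
      assume [measurable]: "G \<in> borel_measurable ((borel \<Otimes>\<^sub>M ?A) \<Otimes>\<^sub>M borel)"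
      show "(\<integral>\<^sup>+ x. G ((snd (snd x), fst x), ?h3 x) \<partial>F)
        = (\<integral>\<^sup>+ x. \<integral>\<^sup>+ b. G ((snd (snd x), fst x), axis s1 (fst (fst ((snd (snd x), fst x), b)) $ j)
            + axis s2 (snd ((snd (snd x), fst x), b))) \<partial>disc R \<partial>F)"
        using i12 by (subst (1 2) nn_integral_disc_input) (simp_all add: axis_nth_neq disc.emeasure_space_1)
    qed simp_all
    show "gaussian_mixture.k (disc R) (\<lambda>z. axis s1 (fst (fst z) $ j) + axis s2 (snd z)) z \<le> 1 / (R\<^sup>2 * pi ^ CARD('r3))"
      for z :: "((complex ^ 't2) \<times> (nat \<Rightarrow> complex)) \<times> _"
      unfolding gaussian_mixture.k_def[OF G] using disc_kernel_le[OF R, of "snd z - axis s1 (fst (fst z) $ j)" s2]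
      by (simp add: diff_diff_eq)
  qed (simp_all add: integrable_disc_input_axis2)
  have m: "0 \<le> ?m2" "0 \<le> ?m3" by simp_all
  show ?thesis
    unfolding R_PDF_def Let_def
  proof (rule SUP_upper2[OF UNIV_I], rule SUP_upper2[OF disc_input_in_pdf_inputs])
    \<comment> \<open>The estimate \<open>1\<close> loses only \<open>?m3\<close>;
      \<open>?m2\<close> is given away so that one number lies below both arguments of the
      minimum.\<close>
    have "(4 * ln R - ?m2 - ?m3) / ln 2 \<le> ?I (borel \<Otimes>\<^sub>M borel) borel (\<lambda>w. (?X1 w, ?X2 w)) ?Y3"
      using 1 m unfolding lnB by (rule_tac order_trans[rotated]) (auto intro!: divide_right_mono)
    moreover have "(4 * ln R - ?m2 - ?m3) / ln 2
      \<le> (?I borel (?A \<Otimes>\<^sub>M borel) ?Y2 (\<lambda>w. (?U w, ?X2 w)) - ?I borel borel ?Y2 ?X2)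
       + (?I borel (borel \<Otimes>\<^sub>M borel \<Otimes>\<^sub>M ?A) ?Y3 (\<lambda>w. (?X1 w, ?X2 w, ?U w)) - ?I borel (borel \<Otimes>\<^sub>M ?A) ?Y3 (\<lambda>w. (?X2 w, ?U w)))"
      using add_mono[OF 2 3] unfolding lnB add_divide_distrib[symmetric] by (simp add: algebra_simps)
    ultimately show "ereal ((4 * ln R - ?m2 - ?m3) / ln 2) \<le> ereal (min
        (?I (borel \<Otimes>\<^sub>M borel) borel
          (\<lambda>w. ((\<lambda>((u, x1, x2), z2, z3). x1) w, (\<lambda>((u, x1, x2), z2, z3). x2) w))
          (\<lambda>((u, x1, x2), z2, z3). unit_matrix s2 i2 *v x1 + unit_matrix s1 j *v x2 + z3))
        (prob_space.conditional_mutual_information (F \<Otimes>\<^sub>M ?N) 2 borel ?A borel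
          (\<lambda>((u, x1, x2), z2, z3). unit_matrix r i1 *v x1 + z2)
          (\<lambda>((u, x1, x2), z2, z3). u) (\<lambda>((u, x1, x2), z2, z3). x2) +
         prob_space.conditional_mutual_information (F \<Otimes>\<^sub>M ?N) 2 borel borel (borel \<Otimes>\<^sub>M ?A)
          (\<lambda>((u, x1, x2), z2, z3). unit_matrix s2 i2 *v x1 + unit_matrix s1 j *v x2 + z3)
          (\<lambda>((u, x1, x2), z2, z3). x1)
          (\<lambda>w. ((\<lambda>((u, x1, x2), z2, z3). x2) w, (\<lambda>((u, x1, x2), z2, z3). u) w))))"
      unfolding ereal_less_eq(3) O2.FN.conditional_mutual_information_def case_prod_unfold unit_matrix_mult
      by (simp add: add.commute)
  qed
qed

end

section \<open>Divergence of the gap\<close>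

theorem proposition5:
  assumes "CARD('t1::finite) \<ge> 2" "CARD('t2::finite) \<ge> 2"
    and "CARD('r2::finite) \<ge> 2" "CARD('r3::finite) \<ge> 2"
  shows "(SUP (G21, G31, G32, P) \<in>
            (UNIV :: (complex ^ 't1 ^ 'r2) set) \<times> (UNIV :: (complex ^ 't1 ^ 'r3) set) \<times>
            (UNIV :: (complex ^ 't2 ^ 'r3) set) \<times> {P :: real. P > 0}.
          R_PDF G21 G31 G32 P - max (R_DF G21 G31 G32 P) (R_DT G31 P)) = (\<infinity> :: ereal)"
    (is "?S = _")
proof (rule ereal_top)
  fix B :: real
  have two: "\<exists>a b :: 'a::finite. a \<noteq> b" if "CARD('a) \<ge> 2"
    using that card_le_Suc0_iff_eq[of "UNIV :: 'a set"] by auto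
  obtain i1 i2 :: 't1 where i: "i1 \<noteq> i2" using two[OF assms(1)] by blast
  obtain s1 s2 :: 'r3 where s: "s1 \<noteq> s2" using two[OF assms(4)] by blast
  obtain j :: 't2 and r :: 'r2 where True by simp
  let ?m2 = "noise_power TYPE('r2)" and ?m3 = "noise_power TYPE('r3)"
  \<comment> \<open>The lower bound contributes one copy of each noise power and the common upper
    bound \<open>?C\<close> two; \<open>ln 5\<close> comes from
    \<open>1 + 4 * R\<^sup>2 \<le> 5 * R\<^sup>2\<close>, and 2 from the scalar bound.\<close>
  define K where "K = 3 * ?m2 + 3 * ?m3 + ln 5 + 2"
  \<comment> \<open>The gap is at least \<open>2 * ln R - K\<close> nats, so this radius makes it at
    least \<open>B\<close> bits. The maximum with 0 ensures \<open>R \<ge> 1\<close>, which absorbs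
    the summand 1 of \<open>1 + P\<close> into \<open>5 * R\<^sup>2\<close>.\<close>
  define R where "R = exp (max 0 ((B * ln 2 + K) / 2))"
  have R: "0 < R" "1 \<le> R" "B * ln 2 + K \<le> 2 * ln R" by (auto simp: R_def max_def)
  define P where "P = 4 * R\<^sup>2"
  have P: "0 < P" using R by (simp add: P_def)
  let ?G21 = "unit_matrix r i1 :: complex ^ 't1 ^ 'r2" and ?G31 = "unit_matrix s2 i2 :: complex ^ 't1 ^ 'r3"
    and ?G32 = "unit_matrix s1 j :: complex ^ 't2 ^ 'r3"
  \<comment> \<open>The noise powers of both receivers are included so that one number dominates
    both the decode-forward rate, limited at the relay, and the direct rate, limited at the
    destination.\<close>
  let ?C = "(2 * ln R + ln 5 + 2 + 2 * ?m2 + 2 * ?m3) / ln 2"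
  let ?L = "(4 * ln R - ?m2 - ?m3) / ln 2"
  have m: "0 \<le> ?m2" "0 \<le> ?m3" by simp_all
  have "ln (1 + P) \<le> ln (5 * R\<^sup>2)"
    using R P one_le_power[of R 2] by (intro ln_mono) (auto simp: P_def intro: add_pos_nonneg)
  also have "\<dots> = 2 * ln R + ln 5" using R by (simp add: ln_mult ln_realpow)
  finally have P5: "ln (1 + P) \<le> 2 * ln R + ln 5" .
  have "R_DF ?G21 ?G31 ?G32 P \<le> ereal ?C"
    by (rule order_trans[OF R_DF_le[OF P]]) (unfold ereal_less_eq, intro divide_right_mono, use P5 m in linarith, simp)
  moreover have "R_DT ?G31 P \<le> ereal ?C"
    by (rule order_trans[OF R_DT_le[OF P]]) (unfold ereal_less_eq, intro divide_right_mono, use P5 m in linarith, simp)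
  ultimately have C: "max (R_DF ?G21 ?G31 ?G32 P) (R_DT ?G31 P) \<le> ereal ?C" by simp
  have L: "ereal ?L \<le> R_PDF ?G21 ?G31 ?G32 P"
    unfolding P_def by (rule R_PDF_ge[OF R(1) i s])
  have "B * ln 2 \<le> (4 * ln R - ?m2 - ?m3) - (2 * ln R + ln 5 + 2 + 2 * ?m2 + 2 * ?m3)"
    using R(3) by (simp add: K_def)
  then have "B \<le> ?L - ?C"
    unfolding diff_divide_distrib[symmetric] by (simp add: pos_le_divide_eq)
  then have "ereal B \<le> ereal ?L - ereal ?C" by simp
  also have "\<dots> \<le> R_PDF ?G21 ?G31 ?G32 P - max (R_DF ?G21 ?G31 ?G32 P) (R_DT ?G31 P)"
    by (intro ereal_minus_mono L C)
  also have "\<dots> \<le> ?S"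
    using P by (intro SUP_upper2[of "(?G21, ?G31, ?G32, P)"]) auto
  finally show "ereal B \<le> ?S" .
qed

end
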